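(* Let $n\ge1$, let $\psi\in\mathcal{T}_n^0$ (extended holomorphically to $\Pi_-^n$ and continuously to $\overline{\Pi_-^n}$), and let $(\nu_t)_{t\ge0}$ be the convolution semigroup of probability measures on $\mathbb{R}_+^n$ with $\int_{\mathbb{R}_+^n}e^{z\cdot u}\,d\nu_t(u)=e^{t\psi(z)}$ for $z\in(-\infty,0)^n$. Suppose the following conditions hold: (a) for every complex Banach space $X$ and all pairwise commuting bounded $C_0$-semigroups $T_1,\dots,T_n$ on $X$, with generators $A=(A_1,\dots,A_n)$, the semigroup $g_t(A)=\int_{\mathbb{R}_+^n}T_1(u_1)\cdots T_n(u_n)\,d\nu_t(u)$ satisfies the Yosida condition (Y) (i.e. its generator $\psi(A)$ is a generator of a quasibounded holomorphic semigroup in $X$); (b) the semigroup $t\mapsto Z_{\nu_t}$ satisfies the Yosida condition (Y) in the space $L^1(\mathbb{R}_+^n)$; (c) the map $t\mapsto\nu_t$, $\mathbb{R}_+\to\mathcal{M}^b(\mathbb{R}_+^n)$, is continuously differentiable (in norm) for $t>0$, with $\|\nu_t'\|_{\mathcal{M}^b}=O(t^{-1})$ as $t\to0+$. Then $\psi$ maps the region $\Pi_-^n$ into a truncated sector $$S(\theta,\beta)=\bigl(\beta+\{z\in\mathbb{C}:|\arg(-z)|<\theta\}\bigr)\cap\Pi_-^1$$ of opening $2\theta<\pi$, and there exist constants $K>0$ and $\gamma\in(0,1)$ such that $$|\psi(z)|\le K\|z\|^\gamma\quad\text{for all } z\in\overline{\Pi_-^n},\ \|z\|\ge1.$$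
   Context: $\mathbb{R}_+=[0,\infty)$. For $z\in\mathbb{C}^n$, $\|z\|=\max_{1\le j\le n}|z_j|$; $\Pi_-^n=\{z\in\mathbb{C}^n:\mathrm{Re}\,z_j<0,\ j=1,\dots,n\}$ and $\overline{\Pi_-^n}$ is its closure; in particular $\Pi_-^1$ is the open left half-plane. A bounded $C_0$-semigroup on a Banach space is a strongly continuous one-parameter operator semigroup $(T(t))_{t\ge0}$ with $\sup_t\|T(t)\|<\infty$. $\mathcal{T}_n$ is the set of nonpositive $\psi\in C^\infty((-\infty,0)^n)$ all of whose first partial derivatives are absolutely monotone (nonnegative together with all their partial derivatives of all orders). Every $\psi\in\mathcal{T}_n$ has a representation $\psi(s)=c_0+c_1\cdot s+\int_{\mathbb{R}_+^n\setminus\{0\}}(e^{s\cdot v}-1)\,d\mu(v)$ with $c_0=\lim_{s\to-0}\psi(s)$, $c_1\in\mathbb{R}_+^n$, and a positive measure $\mu$ on $\mathbb{R}_+^n\setminus\{0\}$, all determined by $\psi$; the same formula extends $\psi$ uniquely to a function holomorphic in $\Pi_-^n$ and continuous on $\overline{\Pi_-^n}$. $\mathcal{T}_n^0$ is the subclass with $c_0=0$, $c_1=0$. For $\psi\in\mathcal{T}_n^0$ the probability measures $\nu_t$ exist, are unique, and form a convolution semigroup with $\nu_0=\delta_0$. For commuting generators $A=(A_1,\dots,A_n)$ of bounded $C_0$-semigroups, $\psi(A)$ denotes the generator of the $C_0$-semigroup $t\mapsto g_t(A)$. Yosida condition (Y): a bounded $C_0$-semigroup $U$ with generator $G$ on $X$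 satisfies (Y) if $U(t)X\subset D(G)$ for all $t>0$ and $\limsup_{t\to0+}t\|GU(t)\|<\infty$. In this case, for any $\beta>0$, $e^{-\beta t}U(t)$ extends to a bounded holomorphic semigroup on $X$, and $U$ is called a quasibounded holomorphic semigroup. $\mathcal{M}^b(\mathbb{R}_+^n)$ is the space of bounded (signed or complex) measures on $\mathbb{R}_+^n$ with the total variation norm, and for $\mu\in\mathcal{M}^b(\mathbb{R}_+^n)$, $f\in L^1(\mathbb{R}_+^n)$ (extended by $0$ outside $\mathbb{R}_+^n$), $(Z_\mu f)(x)=\int_{\mathbb{R}_+^n}f(x-u)\,d\mu(u)$.
   Formalization: The claim that ψ maps Π_-^n into a truncated sector is stated only for ψ not identically zero: for ψ = 0 conditions (a)–(c) hold, but the image {0} does not lie in the open left half-plane; the growth estimate is stated for all ψ. *)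

theory Defs
  imports "HOL-Probability.Probability" "HOL-Library.Landau_Symbols"
begin

section \<open>Complex normed spaces\<close>

class scaleC =
  fixes scaleC :: "complex \<Rightarrow> 'a \<Rightarrow> 'a" (infixr \<open>*\<^sub>C\<close> 75)

class complex_normed_vector = real_normed_vector + scaleC +
  assumes scaleC_add_right: "a *\<^sub>C (x + y) = a *\<^sub>C x + a *\<^sub>C y"
    and scaleC_add_left: "(a + b) *\<^sub>C x = a *\<^sub>C x + b *\<^sub>C x"
    and scaleC_scaleC: "a *\<^sub>C (b *\<^sub>C x) = (a * b) *\<^sub>C x"
    and scaleC_of_real: "of_real r *\<^sub>C x = r *\<^sub>R x"
    and norm_scaleC: "norm (a *\<^sub>C x) = cmod a * norm x"

class complex_banach = complex_normed_vector + banach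

text \<open>
  A closed complex subspace of a complex Banach space, regarded as a complex Banach space in its
  own right. The operator-theoretic notions below are relative to such a set X, and maps are only
  looked at on X. This makes it possible to quantify over Banach spaces inside a formula.
\<close>

definition closed_csubspace :: "'a::complex_normed_vector set \<Rightarrow> bool" where
  "closed_csubspace X \<longleftrightarrow> closed X \<and> 0 \<in> X \<and>
     (\<forall>x\<in>X. \<forall>y\<in>X. x + y \<in> X) \<and> (\<forall>c. \<forall>x\<in>X. c *\<^sub>C x \<in> X)"


section \<open>Semigroups, generators and the Yosida condition\<close>

definition bounded_C0_semigroup ::
    "'a::complex_normed_vector set \<Rightarrow> (real \<Rightarrow> 'a \<Rightarrow> 'a) \<Rightarrow> bool" where
  "bounded_C0_semigroup X T \<longleftrightarrow>
     (\<forall>t\<ge>0. \<forall>x\<in>X. T t x \<in> X) \<and>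
     (\<forall>t\<ge>0. \<forall>x\<in>X. \<forall>y\<in>X. T t (x + y) = T t x + T t y) \<and>
     (\<forall>t\<ge>0. \<forall>c. \<forall>x\<in>X. T t (c *\<^sub>C x) = c *\<^sub>C T t x) \<and>
     (\<forall>x\<in>X. T 0 x = x) \<and>
     (\<forall>s\<ge>0. \<forall>t\<ge>0. \<forall>x\<in>X. T (s + t) x = T s (T t x)) \<and>
     (\<forall>x\<in>X. continuous_on {0..} (\<lambda>t. T t x)) \<and>
     (\<exists>M. \<forall>t\<ge>0. \<forall>x\<in>X. norm (T t x) \<le> M * norm x)"

definition gen_dom :: "'a::complex_normed_vector set \<Rightarrow> (real \<Rightarrow> 'a \<Rightarrow> 'a) \<Rightarrow> 'a set" where
  "gen_dom X U = {x\<in>X. \<exists>y\<in>X. ((\<lambda>t. (U t x - x) /\<^sub>R t) \<longlongrightarrow> y) (at_right 0)}"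

definition gen :: "(real \<Rightarrow> 'a \<Rightarrow> 'a) \<Rightarrow> 'a \<Rightarrow> 'a::complex_normed_vector" where
  "gen U x = Lim (at_right 0) (\<lambda>t. (U t x - x) /\<^sub>R t)"

text \<open>The operator norm is taken in the extended reals, so it is infinite for unbounded operators.\<close>

definition op_norm :: "'a::complex_normed_vector set \<Rightarrow> ('a \<Rightarrow> 'a) \<Rightarrow> ereal" where
  "op_norm X B = (SUP x\<in>{x\<in>X. norm x \<le> 1}. ereal (norm (B x)))"

definition yosida :: "'a::complex_normed_vector set \<Rightarrow> (real \<Rightarrow> 'a \<Rightarrow> 'a) \<Rightarrow> bool" where
  "yosida X U \<longleftrightarrow>
     (\<forall>t>0. \<forall>x\<in>X. U t x \<in> gen_dom X U) \<and>
     Limsup (at_right 0) (\<lambda>t. ereal t * op_norm X (\<lambda>x. gen U (U t x))) < \<infinity>"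


section \<open>The Bochner integral without separability\<close>

text \<open>
  The library's Bochner integral is restricted to second-countable spaces. This is its definition
  with that sort constraint dropped.
\<close>

definition has_bochner_int :: "'u measure \<Rightarrow> ('u \<Rightarrow> 'a) \<Rightarrow> 'a::complex_banach \<Rightarrow> bool" where
  "has_bochner_int M f y \<longleftrightarrow> f \<in> borel_measurable M \<and>
     (\<exists>s. (\<forall>i. Bochner_Integration.simple_bochner_integrable M (s i)) \<and>
          (\<lambda>i. \<integral>\<^sup>+ u. ennreal (norm (f u - s i u)) \<partial>M) \<longlonglongrightarrow> 0 \<and>
          (\<lambda>i. Bochner_Integration.simple_bochner_integral M (s i)) \<longlonglongrightarrow> y)"


section \<open>Regions and norms\<close>

definition nonneg_orthant :: "(real ^ 'n) set" where
  "nonneg_orthant = {u. \<forall>j. 0 \<le> u $ j}"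

definition neg_orthant :: "(real ^ 'n) set" where
  "neg_orthant = {s. \<forall>j. s $ j < 0}"

definition Pi_minus :: "(complex ^ 'n) set" where
  "Pi_minus = {z. \<forall>j. Re (z $ j) < 0}"

definition max_norm :: "complex ^ 'n \<Rightarrow> real" where
  "max_norm z = Max (range (\<lambda>j. cmod (z $ j)))"

definition truncated_sector :: "real \<Rightarrow> real \<Rightarrow> complex set" where
  "truncated_sector \<theta> \<beta> =
     (\<lambda>z. of_real \<beta> + z) ` {z. z \<noteq> 0 \<and> \<bar>Arg (- z)\<bar> < \<theta>} \<inter> {w. Re w < 0}"

definition cvec :: "real ^ 'n \<Rightarrow> complex ^ 'n" where
  "cvec s = (\<chi> j. of_real (s $ j))"

definition holomorphic_vec :: "(complex ^ 'n \<Rightarrow> complex) \<Rightarrow> (complex ^ 'n) set \<Rightarrow> bool" where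
  "holomorphic_vec f S \<longleftrightarrow>
     (\<forall>z\<in>S. \<exists>D. (f has_derivative D) (at z) \<and> (\<forall>c v. D (c *s v) = c * D v))"


section \<open>The class of symbols\<close>

definition partial_deriv :: "'n \<Rightarrow> (real ^ 'n \<Rightarrow> real) \<Rightarrow> real ^ 'n \<Rightarrow> real" where
  "partial_deriv j f s = deriv (\<lambda>h. f (s + h *\<^sub>R axis j 1)) 0"

definition partial_derivs :: "'n list \<Rightarrow> (real ^ 'n \<Rightarrow> real) \<Rightarrow> real ^ 'n \<Rightarrow> real" where
  "partial_derivs js f = foldr partial_deriv js f"

definition smooth_neg_orthant :: "(real ^ 'n \<Rightarrow> real) \<Rightarrow> bool" where
  "smooth_neg_orthant f \<longleftrightarrow>
     (\<forall>js. continuous_on neg_orthant (partial_derivs js f) \<and>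
        (\<forall>s\<in>neg_orthant. \<forall>j.
           (\<lambda>h. partial_derivs js f (s + h *\<^sub>R axis j 1)) differentiable (at 0)))"

definition absolutely_monotone :: "(real ^ 'n \<Rightarrow> real) \<Rightarrow> bool" where
  "absolutely_monotone f \<longleftrightarrow> (\<forall>js. \<forall>s\<in>neg_orthant. 0 \<le> partial_derivs js f s)"

definition T_class :: "(real ^ 'n \<Rightarrow> real) set" where
  "T_class = {\<psi>. (\<forall>s\<in>neg_orthant. \<psi> s \<le> 0) \<and> smooth_neg_orthant \<psi> \<and>
     (\<forall>j. absolutely_monotone (partial_deriv j \<psi>))}"

definition represents ::
    "real \<Rightarrow> real ^ 'n \<Rightarrow> (real ^ 'n) measure \<Rightarrow> (real ^ 'n \<Rightarrow> real) \<Rightarrow> bool" where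
  "represents c0 c1 \<mu> \<psi> \<longleftrightarrow>
     c1 \<in> nonneg_orthant \<and>
     sets \<mu> = sets borel \<and> emeasure \<mu> (- (nonneg_orthant - {0})) = 0 \<and>
     (\<forall>s\<in>neg_orthant. integrable \<mu> (\<lambda>v. exp (s \<bullet> v) - 1) \<and>
        \<psi> s = c0 + c1 \<bullet> s + (\<integral>v. (exp (s \<bullet> v) - 1) \<partial>\<mu>))"

text \<open>The data \<open>c0, c1, \<mu>\<close> of the representation are uniquely determined by the function.\<close>

definition T0_class :: "(real ^ 'n \<Rightarrow> real) set" where
  "T0_class = {\<psi>\<in>T_class. \<exists>\<mu>. represents 0 0 \<mu> \<psi>}"

definition symbol_extension :: "(real ^ 'n \<Rightarrow> real) \<Rightarrow> (complex ^ 'n \<Rightarrow> complex) \<Rightarrow> bool" where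
  "symbol_extension \<psi> \<Psi> \<longleftrightarrow>
     holomorphic_vec \<Psi> Pi_minus \<and> continuous_on (closure Pi_minus) \<Psi> \<and>
     (\<forall>s\<in>neg_orthant. \<Psi> (cvec s) = of_real (\<psi> s))"

text \<open>Measures on the nonnegative orthant are Borel measures on the whole space concentrated there.\<close>

definition convolution_semigroup :: "(real \<Rightarrow> (real ^ 'n) measure) \<Rightarrow> bool" where
  "convolution_semigroup \<nu> \<longleftrightarrow>
     (\<forall>t\<ge>0. prob_space (\<nu> t) \<and> sets (\<nu> t) = sets borel \<and>
        emeasure (\<nu> t) (- nonneg_orthant) = 0) \<and>
     \<nu> 0 = return borel 0 \<and>
     (\<forall>s\<ge>0. \<forall>t\<ge>0. \<nu> (s + t) = (\<nu> s \<star> \<nu> t))"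


section \<open>The subordinate semigroup\<close>

text \<open>
  The product of the commuting operators \<open>T j (u $ j)\<close>, applied to x; by commutativity on
  the space under consideration, the order in which the fold runs through the indices is
  irrelevant.
\<close>

definition multi_semigroup :: "('n::finite \<Rightarrow> real \<Rightarrow> 'a \<Rightarrow> 'a) \<Rightarrow> real ^ 'n \<Rightarrow> 'a \<Rightarrow> 'a" where
  "multi_semigroup T u x = Finite_Set.fold (\<lambda>j. T j (u $ j)) x UNIV"

definition commuting_on :: "'a set \<Rightarrow> ('n \<Rightarrow> real \<Rightarrow> 'a \<Rightarrow> 'a) \<Rightarrow> bool" where
  "commuting_on X T \<longleftrightarrow>
     (\<forall>i j. \<forall>s\<ge>0. \<forall>t\<ge>0. \<forall>x\<in>X. T i s (T j t x) = T j t (T i s x))"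

definition subordinate ::
    "(real \<Rightarrow> (real ^ 'n) measure) \<Rightarrow> ('n \<Rightarrow> real \<Rightarrow> 'a \<Rightarrow> 'a) \<Rightarrow> real \<Rightarrow> 'a \<Rightarrow> 'a::complex_banach" where
  "subordinate \<nu> T t x =
     (THE y. has_bochner_int (\<nu> t) (\<lambda>u. indicator nonneg_orthant u *\<^sub>R multi_semigroup T u x) y)"


section \<open>Bounded complex measures on the nonnegative orthant\<close>

definition orthant_borel :: "(real ^ 'n) set set" where
  "orthant_borel = {A\<in>sets borel. A \<subseteq> nonneg_orthant}"

definition orthant_partitions :: "(real ^ 'n) set set set" where
  "orthant_partitions = {P. finite P \<and> P \<subseteq> orthant_borel \<and> disjoint P}"

definition tv_norm :: "((real ^ 'n) set \<Rightarrow> complex) \<Rightarrow> real" where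
  "tv_norm m = (SUP P\<in>orthant_partitions. \<Sum>A\<in>P. cmod (m A))"

definition bounded_cmeasure :: "((real ^ 'n) set \<Rightarrow> complex) \<Rightarrow> bool" where
  "bounded_cmeasure m \<longleftrightarrow>
     (\<forall>A. A \<notin> orthant_borel \<longrightarrow> m A = 0) \<and>
     (\<forall>F::nat \<Rightarrow> (real ^ 'n) set. range F \<subseteq> orthant_borel \<longrightarrow> disjoint_family F \<longrightarrow>
        (\<lambda>i. m (F i)) sums m (\<Union>i. F i)) \<and>
     bdd_above ((\<lambda>P. \<Sum>A\<in>P. cmod (m A)) ` orthant_partitions)"

lemma orthant_partitions_empty: "{} \<in> orthant_partitions"
  by (simp add: orthant_partitions_def)

lemma bounded_cmeasure_zero: "bounded_cmeasure (\<lambda>A. 0)"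
  by (auto simp: bounded_cmeasure_def)

lemma bounded_cmeasure_bound:
  assumes "bounded_cmeasure m" and "P \<in> orthant_partitions"
  shows "(\<Sum>A\<in>P. cmod (m A)) \<le> tv_norm m"
  unfolding tv_norm_def using assms by (intro cSUP_upper) (auto simp: bounded_cmeasure_def)

lemma tv_norm_le:
  assumes "\<And>P. P \<in> orthant_partitions \<Longrightarrow> (\<Sum>A\<in>P. cmod (m A)) \<le> C"
  shows "tv_norm m \<le> C"
  unfolding tv_norm_def using assms orthant_partitions_empty by (intro cSUP_least) auto

lemma bounded_cmeasure_add:
  assumes m: "bounded_cmeasure m" and k: "bounded_cmeasure k"
  shows "bounded_cmeasure (\<lambda>A. m A + k A)" and "tv_norm (\<lambda>A. m A + k A) \<le> tv_norm m + tv_norm k"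
proof -
  have *: "(\<Sum>A\<in>P. cmod (m A + k A)) \<le> tv_norm m + tv_norm k" if "P \<in> orthant_partitions" for P
  proof -
    have "(\<Sum>A\<in>P. cmod (m A + k A)) \<le> (\<Sum>A\<in>P. cmod (m A)) + (\<Sum>A\<in>P. cmod (k A))"
      unfolding sum.distrib[symmetric] by (intro sum_mono norm_triangle_ineq)
    with bounded_cmeasure_bound[OF m that] bounded_cmeasure_bound[OF k that] show ?thesis by simp
  qed
  then show "bounded_cmeasure (\<lambda>A. m A + k A)"
    using m k unfolding bounded_cmeasure_def by (auto intro!: sums_add bdd_aboveI2)
  show "tv_norm (\<lambda>A. m A + k A) \<le> tv_norm m + tv_norm k"
    using * by (rule tv_norm_le)
qed

lemma bounded_cmeasure_scale:
  assumes m: "bounded_cmeasure m"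
  shows "bounded_cmeasure (\<lambda>A. c * m A)" and "tv_norm (\<lambda>A. c * m A) \<le> cmod c * tv_norm m"
proof -
  have *: "(\<Sum>A\<in>P. cmod (c * m A)) \<le> cmod c * tv_norm m" if "P \<in> orthant_partitions" for P
    using bounded_cmeasure_bound[OF m that]
    by (simp add: norm_mult sum_distrib_left[symmetric] mult_left_mono)
  then show "bounded_cmeasure (\<lambda>A. c * m A)"
    using m unfolding bounded_cmeasure_def by (auto intro!: sums_mult bdd_aboveI2)
  show "tv_norm (\<lambda>A. c * m A) \<le> cmod c * tv_norm m"
    using * by (rule tv_norm_le)
qed

lemma tv_norm_zero: "tv_norm (\<lambda>A::(real ^ 'n) set. 0) = 0"
proof -
  have "(orthant_partitions :: (real ^ 'n) set set set) \<noteq> {}"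
    using orthant_partitions_empty by blast
  then show ?thesis by (simp add: tv_norm_def)
qed

lemma tv_norm_scale:
  assumes m: "bounded_cmeasure m"
  shows "tv_norm (\<lambda>A. c * m A) = cmod c * tv_norm m"
proof (cases "c = 0")
  case True
  then show ?thesis by (simp add: tv_norm_zero)
next
  case False
  have "tv_norm (\<lambda>A. inverse c * (c * m A)) \<le> cmod (inverse c) * tv_norm (\<lambda>A. c * m A)"
    by (intro bounded_cmeasure_scale m)
  with False have "cmod c * tv_norm m \<le> tv_norm (\<lambda>A. c * m A)"
    by (simp add: mult.assoc[symmetric] norm_inverse norm_divide field_simps)
  with bounded_cmeasure_scale(2)[OF m, of c] show ?thesis by simp
qed

lemma tv_norm_eq_0:
  assumes m: "bounded_cmeasure m"
  shows "tv_norm m = 0 \<longleftrightarrow> m = (\<lambda>A. 0)"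
proof
  assume 0: "tv_norm m = 0"
  show "m = (\<lambda>A. 0)"
  proof
    fix A
    show "m A = 0"
    proof (cases "A \<in> orthant_borel")
      case True
      then have "{A} \<in> orthant_partitions" by (simp add: orthant_partitions_def)
      from bounded_cmeasure_bound[OF m this] 0 show ?thesis by simp
    qed (use m in \<open>simp add: bounded_cmeasure_def\<close>)
  qed
next
  assume "m = (\<lambda>A. 0)"
  then show "tv_norm m = 0" by (simp add: tv_norm_zero)
qed

typedef (overloaded) 'n bmeasure = "{m :: (real ^ 'n::finite) set \<Rightarrow> complex. bounded_cmeasure m}"
  morphisms bmeasure_of Abs_bmeasure
  using bounded_cmeasure_zero by blast

setup_lifting type_definition_bmeasure

instantiation bmeasure :: (finite) real_normed_vector
begin

lift_definition zero_bmeasure :: "'a bmeasure" is "\<lambda>A. 0"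
  by (rule bounded_cmeasure_zero)

lift_definition plus_bmeasure :: "'a bmeasure \<Rightarrow> 'a bmeasure \<Rightarrow> 'a bmeasure" is "\<lambda>m k A. m A + k A"
  by (rule bounded_cmeasure_add)

lift_definition uminus_bmeasure :: "'a bmeasure \<Rightarrow> 'a bmeasure" is "\<lambda>m A. - m A"
  using bounded_cmeasure_scale(1)[where c = "-1"] by simp

definition minus_bmeasure :: "'a bmeasure \<Rightarrow> 'a bmeasure \<Rightarrow> 'a bmeasure" where
  "minus_bmeasure m k = m + (- k)"

lift_definition scaleR_bmeasure :: "real \<Rightarrow> 'a bmeasure \<Rightarrow> 'a bmeasure" is
  "\<lambda>r m A. of_real r * m A"
  by (rule bounded_cmeasure_scale)

lift_definition norm_bmeasure :: "'a bmeasure \<Rightarrow> real" is tv_norm .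

definition sgn_bmeasure :: "'a bmeasure \<Rightarrow> 'a bmeasure" where
  "sgn_bmeasure m = inverse (norm m) *\<^sub>R m"

definition dist_bmeasure :: "'a bmeasure \<Rightarrow> 'a bmeasure \<Rightarrow> real" where
  "dist_bmeasure m k = norm (m - k)"

definition uniformity_bmeasure :: "('a bmeasure \<times> 'a bmeasure) filter" where
  "uniformity_bmeasure = (INF e\<in>{0<..}. principal {(x, y). dist x y < e})"

definition open_bmeasure :: "'a bmeasure set \<Rightarrow> bool" where
  "open_bmeasure S \<longleftrightarrow> (\<forall>x\<in>S. \<forall>\<^sub>F (x', y) in uniformity. x' = x \<longrightarrow> y \<in> S)"

instance
proof
  fix a b c :: "'a bmeasure" and r s :: real
  show "a + b + c = a + (b + c)" by transfer (simp add: add.assoc)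
  show "a + b = b + a" by transfer (simp add: add.commute)
  show "0 + a = a" by transfer simp
  show "- a + a = 0" by transfer simp
  show "a - b = a + - b" by (simp add: minus_bmeasure_def)
  show "r *\<^sub>R (a + b) = r *\<^sub>R a + r *\<^sub>R b" by transfer (simp add: algebra_simps)
  show "(r + s) *\<^sub>R a = r *\<^sub>R a + s *\<^sub>R a" by transfer (simp add: algebra_simps)
  show "r *\<^sub>R s *\<^sub>R a = (r * s) *\<^sub>R a" by transfer (simp add: algebra_simps)
  show "1 *\<^sub>R a = a" by transfer simp
  show "norm (r *\<^sub>R a) = \<bar>r\<bar> * norm a" by transfer (simp add: tv_norm_scale)
  show "norm (a + b) \<le> norm a + norm b" by transfer (rule bounded_cmeasure_add)
  show "(norm a = 0) = (a = 0)" by transfer (rule tv_norm_eq_0)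
qed (simp_all add: sgn_bmeasure_def dist_bmeasure_def uniformity_bmeasure_def open_bmeasure_def)

end

definition bmeasure_of_measure :: "(real ^ 'n) measure \<Rightarrow> 'n::finite bmeasure" where
  "bmeasure_of_measure M =
     Abs_bmeasure (\<lambda>A. if A \<in> orthant_borel then of_real (measure M A) else 0)"


section \<open>The space of integrable functions on the nonnegative orthant\<close>

text \<open>Representatives are defined on the whole space and vanish outside the orthant.\<close>

definition L1_fun :: "(real ^ 'n \<Rightarrow> complex) \<Rightarrow> bool" where
  "L1_fun f \<longleftrightarrow> integrable lborel f \<and> (\<forall>x. x \<notin> nonneg_orthant \<longrightarrow> f x = 0)"

definition L1_rel :: "(real ^ 'n \<Rightarrow> complex) \<Rightarrow> (real ^ 'n \<Rightarrow> complex) \<Rightarrow> bool" where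
  "L1_rel f g \<longleftrightarrow> L1_fun f \<and> L1_fun g \<and> (AE x in lborel. f x = g x)"

lemma L1_fun_0: "L1_fun (\<lambda>x. 0)"
  by (simp add: L1_fun_def)

lemma part_equivp_L1_rel: "part_equivp (L1_rel :: (real ^ 'n \<Rightarrow> complex) \<Rightarrow> _)"
proof (rule part_equivpI)
  show "\<exists>f::real ^ 'n \<Rightarrow> complex. L1_rel f f"
    using L1_fun_0 by (auto simp: L1_rel_def)
  show "symp (L1_rel :: (real ^ 'n \<Rightarrow> complex) \<Rightarrow> _)"
    by (rule sympI) (auto simp: L1_rel_def elim: eventually_mono)
  show "transp (L1_rel :: (real ^ 'n \<Rightarrow> complex) \<Rightarrow> _)"
    by (rule transpI) (auto simp: L1_rel_def elim: eventually_elim2)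
qed

quotient_type (overloaded) 'n L1 = "real ^ ('n::finite) \<Rightarrow> complex" / partial: L1_rel
  by (rule part_equivp_L1_rel)

instantiation L1 :: (finite) complex_normed_vector
begin

lift_definition zero_L1 :: "'a L1" is "\<lambda>x. 0"
  by (simp add: L1_rel_def L1_fun_0)

lift_definition plus_L1 :: "'a L1 \<Rightarrow> 'a L1 \<Rightarrow> 'a L1" is "\<lambda>f g x. f x + g x"
  by (auto simp: L1_rel_def L1_fun_def elim: eventually_elim2)

lift_definition uminus_L1 :: "'a L1 \<Rightarrow> 'a L1" is "\<lambda>f x. - f x"
  by (auto simp: L1_rel_def L1_fun_def elim: eventually_mono)

definition minus_L1 :: "'a L1 \<Rightarrow> 'a L1 \<Rightarrow> 'a L1" where
  "minus_L1 f g = f + (- g)"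

lift_definition scaleR_L1 :: "real \<Rightarrow> 'a L1 \<Rightarrow> 'a L1" is "\<lambda>r f x. of_real r * f x"
  by (auto simp: L1_rel_def L1_fun_def elim: eventually_mono)

lift_definition scaleC_L1 :: "complex \<Rightarrow> 'a L1 \<Rightarrow> 'a L1" is "\<lambda>c f x. c * f x"
  by (auto simp: L1_rel_def L1_fun_def elim: eventually_mono)

lift_definition norm_L1 :: "'a L1 \<Rightarrow> real" is "\<lambda>f. \<integral>x. cmod (f x) \<partial>lborel"
  unfolding L1_rel_def L1_fun_def
  by (rule integral_cong_AE) (auto elim: eventually_mono)

definition sgn_L1 :: "'a L1 \<Rightarrow> 'a L1" where
  "sgn_L1 f = inverse (norm f) *\<^sub>R f"

definition dist_L1 :: "'a L1 \<Rightarrow> 'a L1 \<Rightarrow> real" where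
  "dist_L1 f g = norm (f - g)"

definition uniformity_L1 :: "('a L1 \<times> 'a L1) filter" where
  "uniformity_L1 = (INF e\<in>{0<..}. principal {(x, y). dist x y < e})"

definition open_L1 :: "'a L1 set \<Rightarrow> bool" where
  "open_L1 S \<longleftrightarrow> (\<forall>x\<in>S. \<forall>\<^sub>F (x', y) in uniformity. x' = x \<longrightarrow> y \<in> S)"

instance
proof
  fix a b c :: "'a L1" and r s :: real and p q :: complex
  have rel: "L1_rel f g" if "L1_fun f" "f = g" for f g :: "real ^ 'a \<Rightarrow> complex"
    using that by (simp add: L1_rel_def)
  show "a + b + c = a + (b + c)"
    by transfer (auto intro!: rel simp: L1_rel_def L1_fun_def algebra_simps)
  show "a + b = b + a"
    by transfer (auto intro!: rel simp: L1_rel_def L1_fun_def algebra_simps)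
  show "0 + a = a"
    by transfer (auto intro!: rel simp: L1_rel_def L1_fun_def)
  show "- a + a = 0"
    by transfer (auto intro!: rel simp: L1_rel_def L1_fun_def)
  show "a - b = a + - b" by (simp add: minus_L1_def)
  show "r *\<^sub>R (a + b) = r *\<^sub>R a + r *\<^sub>R b"
    by transfer (auto intro!: rel simp: L1_rel_def L1_fun_def algebra_simps)
  show "(r + s) *\<^sub>R a = r *\<^sub>R a + s *\<^sub>R a"
    by transfer (auto intro!: rel simp: L1_rel_def L1_fun_def algebra_simps)
  show "r *\<^sub>R s *\<^sub>R a = (r * s) *\<^sub>R a"
    by transfer (auto intro!: rel simp: L1_rel_def L1_fun_def algebra_simps)
  show "1 *\<^sub>R a = a"
    by transfer (auto intro!: rel simp: L1_rel_def L1_fun_def)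
  show "p *\<^sub>C (a + b) = p *\<^sub>C a + p *\<^sub>C b"
    by transfer (auto intro!: rel simp: L1_rel_def L1_fun_def algebra_simps)
  show "(p + q) *\<^sub>C a = p *\<^sub>C a + q *\<^sub>C a"
    by transfer (auto intro!: rel simp: L1_rel_def L1_fun_def algebra_simps)
  show "p *\<^sub>C q *\<^sub>C a = (p * q) *\<^sub>C a"
    by transfer (auto intro!: rel simp: L1_rel_def L1_fun_def algebra_simps)
  show "of_real r *\<^sub>C a = r *\<^sub>R a"
    by transfer (auto intro!: rel simp: L1_rel_def L1_fun_def)
  show "norm (r *\<^sub>R a) = \<bar>r\<bar> * norm a"
    by transfer (simp add: norm_mult)
  show "norm (p *\<^sub>C a) = cmod p * norm a"
    by transfer (simp add: norm_mult)
  show "norm (a + b) \<le> norm a + norm b"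
  proof transfer
    fix f g :: "real ^ 'a \<Rightarrow> complex"
    assume "L1_rel f f" "L1_rel g g"
    then have "integrable lborel f" "integrable lborel g" by (auto simp: L1_rel_def L1_fun_def)
    then have "(\<integral>x. cmod (f x + g x) \<partial>lborel) \<le> (\<integral>x. cmod (f x) + cmod (g x) \<partial>lborel)"
      by (intro integral_mono) (auto intro: norm_triangle_ineq)
    also have "\<dots> = (\<integral>x. cmod (f x) \<partial>lborel) + (\<integral>x. cmod (g x) \<partial>lborel)"
      using \<open>integrable lborel f\<close> \<open>integrable lborel g\<close> by simp
    finally show "(\<integral>x. cmod (f x + g x) \<partial>lborel)
      \<le> (\<integral>x. cmod (f x) \<partial>lborel) + (\<integral>x. cmod (g x) \<partial>lborel)" .
  qed
  show "(norm a = 0) = (a = 0)"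
  proof transfer
    fix f :: "real ^ 'a \<Rightarrow> complex"
    assume f: "L1_rel f f"
    then have "integrable lborel (\<lambda>x. cmod (f x))" by (auto simp: L1_rel_def L1_fun_def)
    then have "(\<integral>x. cmod (f x) \<partial>lborel) = 0 \<longleftrightarrow> (AE x in lborel. cmod (f x) = 0)"
      by (rule integral_nonneg_eq_0_iff_AE) simp
    with f show "((\<integral>x. cmod (f x) \<partial>lborel) = 0) = L1_rel f (\<lambda>x. 0)"
      by (simp add: L1_rel_def L1_fun_0)
  qed
qed (simp_all add: sgn_L1_def dist_L1_def uniformity_L1_def open_L1_def)

end

text \<open>The convolution operator; the class of the result does not depend on the representative.\<close>

definition Z_op :: "(real ^ 'n) measure \<Rightarrow> 'n L1 \<Rightarrow> 'n::finite L1" where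
  "Z_op M F = abs_L1 (\<lambda>x. \<integral>u. rep_L1 F (x - u) \<partial>M)"

end

theory Submission
  imports Defs "HOL-Complex_Analysis.Complex_Analysis"
begin

text \<open>
  By the identity theorem, applied along complex lines, the Laplace transform of \<open>\<nu>\<^sub>t\<close> is
  \<open>exp (t \<psi>(z))\<close> on all of \<open>\<Pi>\<^sub>-\<close>, so differentiating in \<open>t\<close> and using \<open>\<parallel>\<nu>\<^sub>t'\<parallel> = O(1 / t)\<close> gives
  \<open>|\<psi>(z)| exp (t Re \<psi>(z)) \<le> C / t\<close> for small \<open>t\<close>. Taking \<open>t = 1 / (\<beta> - Re \<psi>(z))\<close> yields
  \<open>|\<psi>(z)| \<le> C e (\<beta> - Re \<psi>(z))\<close>, i.e. \<open>\<beta> - \<psi>\<close> takes values in a sector \<open>|arg| < \<theta> < \<pi>/2\<close>.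

  Then \<open>\<beta> - \<psi>\<close> raised to the power \<open>\<pi> / (2 \<theta>)\<close> has positive real part, and the Schwarz lemma
  shows that it grows at most linearly along the diagonal ray; hence
  \<open>|\<psi>(-r, \<dots>, -r)| = O(r\<^sup>\<gamma>)\<close> with \<open>\<gamma> = 2 \<theta> / \<pi> < 1\<close>. Finally
  \<open>|exp (z \<cdot> u) - 1| \<le> 3 (1 - exp (- r (u\<^sub>1 + \<dots> + u\<^sub>n)))\<close> for \<open>\<parallel>z\<parallel> \<le> r\<close>; integrating this
  against \<open>\<nu>\<^sub>t\<close> and letting \<open>t \<rightarrow> 0\<close> bounds \<open>|\<psi>(z)|\<close> by \<open>3 |\<psi>(-r, \<dots>, -r)|\<close>.
\<close>

no_notation fps_nth (infixl "$" 75)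

section \<open>Laplace transforms of measures on the orthant\<close>

text \<open>Mean value inequality on the convex half-plane \<open>Re z \<le> c\<close>, where
  \<open>exp\<close>, being its own derivative, has modulus at most \<open>exp c\<close>.\<close>

lemma norm_exp_diff_le:
  assumes "Re x \<le> c" "Re y \<le> c"
  shows "cmod (exp x - exp y) \<le> exp c * cmod (x - y)"
proof (rule field_differentiable_bound)
  show "convex {z. Re z \<le> c}" by (rule convex_halfspace_Re_le)
  show "(exp has_field_derivative exp z) (at z within {z. Re z \<le> c})" for z
    by (rule DERIV_subset[OF DERIV_exp]) auto
qed (use assms in auto)

text \<open>The bilinear pairing, without conjugation, so that it is complex linear in
  \<open>z\<close>.\<close>

definition cdot :: "complex ^ 'n \<Rightarrow> real ^ 'n \<Rightarrow> complex" where
  "cdot z u = (\<Sum>j\<in>UNIV. z $ j * of_real (u $ j))"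

text \<open>The exponent carries no minus sign, so the integrand is bounded on the orthant when the
  coordinates of \<open>z\<close> lie in the closed left half-plane.\<close>

definition laplace :: "(real ^ 'n) measure \<Rightarrow> complex ^ 'n \<Rightarrow> complex" where
  "laplace M z = (\<integral>u. exp (cdot z u) \<partial>M)"

lemma cdot_add_scale: "cdot (z + h *s b) u = cdot z u + h * cdot b u"
  by (simp add: cdot_def sum.distrib sum_distrib_left algebra_simps)

lemma cdot_cvec: "cdot (cvec s) u = of_real (s \<bullet> u)"
  by (simp add: cdot_def cvec_def inner_vec_def)

lemma continuous_on_cdot: "continuous_on A (cdot z)"
  unfolding cdot_def by (intro continuous_intros)

lemma measurable_cdot [measurable]: "cdot z \<in> borel_measurable borel"
  by (intro borel_measurable_continuous_onI continuous_on_cdot)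

lemma norm_le_max_norm: "cmod (z $ j) \<le> max_norm z"
  unfolding max_norm_def by (intro Max_ge) auto

lemma max_norm_nonneg: "0 \<le> max_norm z"
  using norm_le_max_norm[of z undefined] norm_ge_zero order_trans by blast

lemma norm_cdot_le:
  assumes "u \<in> nonneg_orthant"
  shows "cmod (cdot z u) \<le> max_norm z * (\<Sum>j\<in>UNIV. u $ j)"
proof -
  have "cmod (cdot z u) \<le> (\<Sum>j\<in>UNIV. cmod (z $ j * of_real (u $ j)))"
    unfolding cdot_def by (rule norm_sum)
  also have "\<dots> \<le> (\<Sum>j\<in>UNIV. max_norm z * u $ j)"
    using assms
    by (intro sum_mono) (auto simp: norm_mult nonneg_orthant_def intro!: mult_right_mono norm_le_max_norm)
  finally show ?thesis by (simp add: sum_distrib_left)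
qed

lemma Re_cdot_le:
  assumes "u \<in> nonneg_orthant" "\<And>j. Re (z $ j) \<le> c"
  shows "Re (cdot z u) \<le> c * (\<Sum>j\<in>UNIV. u $ j)"
  unfolding cdot_def sum_distrib_left
  using assms by (auto simp: nonneg_orthant_def intro!: sum_mono mult_right_mono)

text \<open>The largest of finitely many real parts is attained, so strict negativity becomes a
  uniform gap. The gap yields exponential decay of \<open>exp (cdot z u)\<close> in the coordinate
  sum of \<open>u\<close>.\<close>

lemma Pi_minus_uniform:
  fixes z :: "complex ^ 'n"
  assumes "z \<in> Pi_minus"
  obtains e where "e > 0" "\<And>j. Re (z $ j) \<le> - e"
proof
  let ?m = "Max (range (\<lambda>j. Re (z $ j)))"
  have "?m \<in> range (\<lambda>j. Re (z $ j))" by (intro Max_in) auto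
  then show "- ?m > 0" using assms by (auto simp: Pi_minus_def)
  show "Re (z $ j) \<le> - (- ?m)" for j
    unfolding minus_minus by (rule Max_ge) auto
qed

text \<open>Finite measures in the encoding of \<open>convolution_semigroup\<close>: Borel on the
  whole space and null off the orthant.\<close>

locale orthant_measure = finite_measure M for M :: "(real ^ 'n) measure" +
  assumes sets_M [measurable_cong]: "sets M = sets borel"
    and null: "emeasure M (- nonneg_orthant) = 0"
begin



lemma orthant_sets: "nonneg_orthant \<in> sets (borel :: (real ^ 'n) measure)"
proof -
  have "closed (nonneg_orthant :: (real ^ 'n) set)"
    unfolding nonneg_orthant_def
    by (intro closed_Collect_all closed_Collect_le continuous_intros)
  then show ?thesis by simp
qed

lemma space_M [simp]: "space M = UNIV"
  using sets_eq_imp_space_eq[OF sets_M] by simp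

lemma AE_orthant: "AE u in M. u \<in> nonneg_orthant"
  using null orthant_sets by (intro AE_I[of _ _ "- nonneg_orthant"]) (auto simp: sets_M)

lemma AE_norm_exp_cdot:
  assumes "\<And>j. Re (z $ j) \<le> 0"
  shows "AE u in M. cmod (exp (cdot z u)) \<le> 1"
  using AE_orthant
proof eventually_elim
  case (elim u)
  then show ?case using Re_cdot_le[OF elim assms] by simp
qed

lemma integrable_exp_cdot:
  assumes "\<And>j. Re (z $ j) \<le> 0"
  shows "integrable M (\<lambda>u. exp (cdot z u))"
  using AE_norm_exp_cdot[OF assms] by (intro integrable_const_bound[of _ 1]) auto

text \<open>Differentiation under the integral by dominated convergence. Since \<open>z\<close> is
  interior, exponential decay absorbs the factor linear in \<open>u\<close> that the derivative
  produces, leaving a constant majorant.\<close>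

lemma laplace_deriv:
  assumes z: "z \<in> Pi_minus"
  shows "((\<lambda>h. laplace M (z + h *s b)) has_field_derivative
           (\<integral>u. cdot b u * exp (cdot z u) \<partial>M)) (at 0)"
proof -
  \<comment> \<open>The added 1 keeps \<open>B\<close> positive when \<open>b = 0\<close>, so that
    the radius \<open>e / (2 * B)\<close> makes sense.\<close>
  define B where "B = max_norm b + 1"
  have B: "B > 0" using max_norm_nonneg[of b] by (simp add: B_def)
  obtain e where e: "e > 0" "\<And>j. Re (z $ j) \<le> - e" using Pi_minus_uniform[OF z, where thesis = thesis] by blast
  let ?q = "\<lambda>h u. (exp (cdot (z + h *s b) u) - exp (cdot z u)) / h"
  have Re_le: "Re (z $ j) \<le> 0" for j using e(1) e(2)[of j] by simp
  have Re_h: "Re ((z + h *s b) $ j) \<le> - e / 2" if "cmod h \<le> e / (2 * B)" for h j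
  proof -
    have "Re (h * b $ j) \<le> cmod h * cmod (b $ j)"
      using complex_Re_le_cmod[of "h * b $ j"] by (simp add: norm_mult)
    also have "\<dots> \<le> e / (2 * B) * B"
    proof (rule mult_mono)
      show "cmod (b $ j) \<le> B" using norm_le_max_norm[of b j] by (simp add: B_def)
    qed (use that e(1) B in auto)
    finally show ?thesis using e(2)[of j] B by simp
  qed
  \<comment> \<open>Both exponents have real part at most \<open>- e / 2 * ?S\<close>. With
    \<open>x = e / 2 * ?S\<close>, the quotient is thus at most \<open>2 * B / e\<close> times
    \<open>x * exp (- x)\<close>, and the latter factor is at most 1.\<close>
  have bound: "cmod (?q h u) \<le> 2 * B / e"
    if h: "h \<noteq> 0" "cmod h \<le> e / (2 * B)" and u: "u \<in> nonneg_orthant" for h u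
  proof -
    let ?S = "\<Sum>j\<in>UNIV. u $ j"
    have S: "0 \<le> ?S" using u by (auto simp: nonneg_orthant_def intro!: sum_nonneg)
    have "cmod (exp (cdot (z + h *s b) u) - exp (cdot z u))
        \<le> exp (- e / 2 * ?S) * cmod (cdot (z + h *s b) u - cdot z u)"
      by (rule norm_exp_diff_le; rule Re_cdot_le[OF u])
        (use Re_h[OF h(2)] Re_le e in \<open>auto intro: order_trans[OF e(2)]\<close>)
    then have "cmod (?q h u) \<le> exp (- e / 2 * ?S) * cmod (cdot b u)"
      using h(1) by (simp add: cdot_add_scale norm_divide norm_mult field_simps)
    also have "\<dots> \<le> exp (- e / 2 * ?S) * (B * ?S)"
    proof (rule mult_left_mono)
      have "max_norm b * ?S \<le> B * ?S" using S by (intro mult_right_mono) (auto simp: B_def)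
      then show "cmod (cdot b u) \<le> B * ?S" using norm_cdot_le[OF u, of b] by simp
    qed simp
    also have "\<dots> = 2 * B / e * (e / 2 * ?S * exp (- (e / 2 * ?S)))"
      using e(1) by (simp add: field_simps)
    also have "\<dots> \<le> 2 * B / e * 1"
    proof (rule mult_left_mono)
      have "e / 2 * ?S \<le> exp (e / 2 * ?S)"
        using exp_ge_add_one_self[of "e / 2 * ?S"] by linarith
      then show "e / 2 * ?S * exp (- (e / 2 * ?S)) \<le> 1"
        by (simp add: exp_minus divide_simps)
    qed (use B e in simp)
    finally show ?thesis by simp
  qed
  have "((\<lambda>h. (laplace M (z + h *s b) - laplace M z) / h) \<longlongrightarrow> (\<integral>u. cdot b u * exp (cdot z u) \<partial>M)) (at 0)"
    unfolding tendsto_at_iff_sequentially comp_def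
  proof safe
    fix X :: "nat \<Rightarrow> complex"
    assume X0: "\<forall>i. X i \<in> UNIV - {0}" and X: "X \<longlonglongrightarrow> 0"
    have "\<forall>\<^sub>F i in sequentially. cmod (X i) < e / (2 * B)"
      using tendsto_norm[OF X] e(1) B by (intro order_tendstoD(2)[where y = "cmod 0"]) auto
    then obtain N where "\<And>i. i \<ge> N \<Longrightarrow> cmod (X i) < e / (2 * B)"
      by (auto simp: eventually_sequentially)
    \<comment> \<open>The majorant is valid only for small increments, so the sequence is shifted by
      \<open>N\<close>; \<open>LIMSEQ_offset\<close> undoes the shift at the end.\<close>
    then have N: "cmod (X (i + N)) \<le> e / (2 * B)" for i by (simp add: less_imp_le)
    have quot: "(laplace M (z + X (i + N) *s b) - laplace M z) / X (i + N)
        = (\<integral>u. ?q (X (i + N)) u \<partial>M)" for i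
    proof -
      have "Re ((z + X (i + N) *s b) $ j) \<le> 0" for j
        using Re_h[OF N, of i j] e(1) by simp
      then show ?thesis
        unfolding laplace_def
        by (simp add: integrable_exp_cdot Re_le Bochner_Integration.integral_diff)
    qed
    have "(\<lambda>i. \<integral>u. ?q (X (i + N)) u \<partial>M) \<longlonglongrightarrow> (\<integral>u. cdot b u * exp (cdot z u) \<partial>M)"
    proof (rule integral_dominated_convergence[where w = "\<lambda>_. 2 * B / e"])
      show "AE u in M. (\<lambda>i. ?q (X (i + N)) u) \<longlonglongrightarrow> cdot b u * exp (cdot z u)"
      proof (rule AE_I2)
        fix u
        have "((\<lambda>h. exp (cdot z u + h * cdot b u)) has_field_derivative
            cdot b u * exp (cdot z u)) (at 0)"
          by (auto intro!: derivative_eq_intros)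
        then have "((\<lambda>h. ?q h u) \<longlongrightarrow> cdot b u * exp (cdot z u)) (at 0)"
          by (simp add: has_field_derivative_iff cdot_add_scale)
        then show "(\<lambda>i. ?q (X (i + N)) u) \<longlonglongrightarrow> cdot b u * exp (cdot z u)"
          unfolding tendsto_at_iff_sequentially comp_def
          using X0 LIMSEQ_ignore_initial_segment[OF X, of N] by simp
      qed
      show "AE u in M. norm (?q (X (i + N)) u) \<le> 2 * B / e" for i
        using AE_orthant by eventually_elim (rule bound; use X0 N in simp)
    qed simp_all
    then have "(\<lambda>i. (laplace M (z + X (i + N) *s b) - laplace M z) / X (i + N))
        \<longlonglongrightarrow> (\<integral>u. cdot b u * exp (cdot z u) \<partial>M)"
      by (simp only: quot)
    then show "(\<lambda>i. (laplace M (z + X i *s b) - laplace M z) / X i)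
        \<longlonglongrightarrow> (\<integral>u. cdot b u * exp (cdot z u) \<partial>M)"
      by (rule LIMSEQ_offset)
  qed
  then show ?thesis by (simp add: has_field_derivative_iff)
qed

text \<open>The derivative at \<open>h = 0\<close> with moving base point \<open>a + l *s b\<close>
  is shifted to the parameter \<open>l\<close>. Restriction to lines makes the one-variable identity
  theorem applicable.\<close>

lemma laplace_holomorphic_line:
  "(\<lambda>l. laplace M (a + l *s b)) holomorphic_on {l. a + l *s b \<in> Pi_minus}"
  unfolding holomorphic_on_def
proof (intro ballI)
  fix l assume "l \<in> {l. a + l *s b \<in> Pi_minus}"
  then have "((\<lambda>h. laplace M ((a + l *s b) + h *s b)) has_field_derivative
      (\<integral>u. cdot b u * exp (cdot (a + l *s b) u) \<partial>M)) (at 0)"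
    by (intro laplace_deriv) auto
  then have "((\<lambda>h. laplace M (a + (h + l) *s b)) has_field_derivative
      (\<integral>u. cdot b u * exp (cdot (a + l *s b) u) \<partial>M)) (at 0)"
    by (simp add: algebra_simps vector_sadd_rdistrib)
  then have "((\<lambda>h. laplace M (a + h *s b)) has_field_derivative
      (\<integral>u. cdot b u * exp (cdot (a + l *s b) u) \<partial>M)) (at (0 + l))"
    by (simp only: DERIV_shift)
  then show "(\<lambda>l. laplace M (a + l *s b)) field_differentiable at l within {l. a + l *s b \<in> Pi_minus}"
    unfolding field_differentiable_def by (auto intro: DERIV_subset)
qed

lemma norm_laplace_le:
  assumes "\<And>j. Re (z $ j) \<le> 0"
  shows "cmod (laplace M z) \<le> measure M UNIV"
proof -
  have "cmod (laplace M z) \<le> (\<integral>u. cmod (exp (cdot z u)) \<partial>M)"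
    unfolding laplace_def by (rule integral_norm_bound)
  also have "\<dots> \<le> (\<integral>u. 1 \<partial>M)"
    using assms
    by (intro integral_mono_AE AE_norm_exp_cdot integrable_norm integrable_exp_cdot) auto
  finally have "cmod (laplace M z) \<le> (\<integral>u. 1 \<partial>M)" .
  then show ?thesis by simp
qed

end

section \<open>Slices of the domain by complex lines, and the identity theorem on them\<close>

lemma connected_line_Pi_minus: "connected {l. a + l *s b \<in> Pi_minus}"
proof (rule convex_connected, rule convexI)
  fix x y :: complex and u v :: real
  assume x: "x \<in> {l. a + l *s b \<in> Pi_minus}" and y: "y \<in> {l. a + l *s b \<in> Pi_minus}"
    and uv: "0 \<le> u" "0 \<le> v" "u + v = 1"
  have "Re ((a + (u *\<^sub>R x + v *\<^sub>R y) *s b) $ j) < 0" for j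
  proof -
    \<comment> \<open>Splitting the constant \<open>a\<close> with the same weights turns the affine
      expression into a convex combination of its two values.\<close>
    have "a = u *\<^sub>R a + v *\<^sub>R a" using uv(3) by (simp flip: scaleR_add_left)
    then have "a $ j = u *\<^sub>R (a $ j) + v *\<^sub>R (a $ j)"
      by (metis vector_add_component vector_scaleR_component)
    then have "Re ((a + (u *\<^sub>R x + v *\<^sub>R y) *s b) $ j)
        = u * Re ((a + x *s b) $ j) + v * Re ((a + y *s b) $ j)"
      by (simp add: complex_eq_iff algebra_simps)
    moreover have "Re ((a + x *s b) $ j) < 0" "Re ((a + y *s b) $ j) < 0"
      using x y unfolding Pi_minus_def by blast+
    ultimately show ?thesis
      using uv convex_bound_lt[of _ 0 _ u v] by simp
  qed
  then show "u *\<^sub>R x + v *\<^sub>R y \<in> {l. a + l *s b \<in> Pi_minus}" unfolding Pi_minus_def by blast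
qed

lemma open_line_Pi_minus: "open {l. a + l *s b \<in> Pi_minus}"
proof -
  have "{l. a + l *s b \<in> Pi_minus} = (\<Inter>j. {l. Re (a $ j + l * b $ j) < 0})"
    by (auto simp: Pi_minus_def)
  also have "open \<dots>"
    by (intro open_INT ballI open_Collect_less continuous_intros) auto
  finally show ?thesis .
qed

text \<open>Complex homogeneity of the differential \<open>D\<close> turns the chain rule along the
  line into multiplication by the number \<open>D b\<close>.\<close>

lemma holomorphic_vec_line:
  assumes "holomorphic_vec f Pi_minus"
  shows "(\<lambda>l. f (a + l *s b)) holomorphic_on {l. a + l *s b \<in> Pi_minus}"
  unfolding holomorphic_on_def
proof (intro ballI)
  fix l assume "l \<in> {l. a + l *s b \<in> Pi_minus}"
  with assms obtain D where D: "(f has_derivative D) (at (a + l *s b))" "\<And>c v. D (c *s v) = c * D v"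
    by (auto simp: holomorphic_vec_def)
  have "((\<lambda>l. a + l *s b) has_derivative (\<lambda>h. h *s b)) (at l)"
  proof -
    have "linear (\<lambda>h. h *s b)"
      by (rule linearI) (simp_all add: vec_eq_iff algebra_simps)
    then have "((\<lambda>h. h *s b) has_derivative (\<lambda>h. h *s b)) (at l)"
      by (simp add: linear_conv_bounded_linear bounded_linear_imp_has_derivative)
    from has_derivative_add[OF has_derivative_const[of a] this] show ?thesis by simp
  qed
  from has_derivative_compose[OF this D(1)]
  have "((\<lambda>l. f (a + l *s b)) has_field_derivative D b) (at l)"
    by (simp add: D(2) has_field_derivative_def mult_commute_abs)
  then show "(\<lambda>l. f (a + l *s b)) field_differentiable at l within {l. a + l *s b \<in> Pi_minus}"
    unfolding field_differentiable_def by (auto intro: DERIV_subset)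
qed

text \<open>With \<open>z = x + \<i> y\<close>, both sides are restricted to the line through
  \<open>cvec x\<close> in direction \<open>cvec y\<close>. Real parameters in the slice give real
  points, where equality is assumed, and the parameter \<open>\<i>\<close> gives \<open>z\<close>;
  the slice is connected and contains both 0 and \<open>\<i>\<close>.\<close>

lemma laplace_eqI:
  assumes M: "orthant_measure M" and f: "holomorphic_vec f Pi_minus"
    and eq: "\<And>s. s \<in> neg_orthant \<Longrightarrow> laplace M (cvec s) = exp (c * f (cvec s))"
    and z: "z \<in> Pi_minus"
  shows "laplace M z = exp (c * f z)"
proof -
  define x y where "x = (\<chi> j. Re (z $ j))" and "y = (\<chi> j. Im (z $ j))"
  let ?S = "{l. cvec x + l *s cvec y \<in> Pi_minus}"
  let ?h = "\<lambda>l. laplace M (cvec x + l *s cvec y) - exp (c * f (cvec x + l *s cvec y))"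
  have real_line: "cvec x + of_real r *s cvec y = cvec (x + r *\<^sub>R y)" for r
    by (simp add: cvec_def vec_eq_iff)
  have cvec_Pi: "cvec s \<in> Pi_minus \<longleftrightarrow> s \<in> neg_orthant" for s :: "real ^ 'a"
    by (simp add: cvec_def Pi_minus_def neg_orthant_def)
  have z_eq: "cvec x + \<i> *s cvec y = z"
    by (simp add: cvec_def vec_eq_iff x_def y_def flip: complex_eq)
  have "?h \<i> = 0"
  proof (rule analytic_continuation[where f = ?h and S = ?S and U = "?S \<inter> range of_real" and \<xi> = 0])
    show "?h holomorphic_on ?S"
      by (intro holomorphic_intros orthant_measure.laplace_holomorphic_line[OF M] holomorphic_vec_line[OF f])
    show "open ?S" by (rule open_line_Pi_minus)
    show "connected ?S" by (rule connected_line_Pi_minus)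
    show "?S \<inter> range of_real \<subseteq> ?S" by blast
    have "cvec x \<in> Pi_minus" using z by (simp add: cvec_def Pi_minus_def x_def)
    then show 0: "0 \<in> ?S" by simp
    show "\<i> \<in> ?S" using z by (simp add: z_eq)
    show "0 islimpt ?S \<inter> range of_real"
      unfolding islimpt_approachable
    proof safe
      fix d :: real assume d: "0 < d"
      obtain e where e: "e > 0" "ball 0 e \<subseteq> ?S"
        using open_line_Pi_minus 0 openE by blast
      define m where "m = min d e / 2"
      have m: "0 < m" "m < d" "m < e" using d e(1) by (auto simp: m_def min_def)
      then have "of_real m \<in> ball (0 :: complex) e" by (simp add: dist_norm)
      with e(2) have "of_real m \<in> ?S" by blast
      with m show "\<exists>x'\<in>?S \<inter> range of_real. x' \<noteq> 0 \<and> dist x' 0 < d"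
        by (intro bexI[of _ "of_real m"]) (auto simp: dist_norm)
    qed
    show "?h l = 0" if "l \<in> ?S \<inter> range of_real" for l
      using that by (auto simp: real_line cvec_Pi eq)
  qed
  then show ?thesis by (simp add: z_eq)
qed

text \<open>The left side is at most \<open>min x 2\<close>, and \<open>x / (1 + x)\<close> is at
  most \<open>1 - exp (- x)\<close>. The constant 3 is what
  \<open>min x 2 \<le> 3 * (x / (1 + x))\<close> requires, with equality at
  \<open>x = 2\<close>.\<close>

lemma norm_exp_minus_1_le:
  assumes "Re z \<le> 0" "cmod z \<le> x"
  shows "cmod (exp z - 1) \<le> 3 * (1 - exp (- x))"
proof -
  have x: "0 \<le> x" using assms(2) norm_ge_zero order_trans by blast
  have "exp (- x) \<le> 1 / (1 + x)"
    using x exp_ge_add_one_self[of x] by (simp add: exp_minus field_simps)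
  then have 1: "x / (1 + x) \<le> 1 - exp (- x)" using x by (simp add: field_simps)
  have "cmod (exp z - 1) \<le> cmod z" using norm_exp_diff_le[of z 0 0] assms(1) by simp
  moreover have "cmod (exp z - 1) \<le> 2"
    using norm_triangle_ineq4[of "exp z" 1] assms(1) by (simp add: order_trans)
  ultimately have "cmod (exp z - 1) \<le> min x 2" using assms(2) by simp
  also have "\<dots> \<le> 3 * (x / (1 + x))"
  proof (cases "x \<le> 2")
    case True
    have "x * x \<le> 2 * x" using True x by (rule mult_right_mono)
    then show ?thesis using True x by (simp add: field_simps)
  next
    case False
    then show ?thesis by (simp add: field_simps)
  qed
  finally show ?thesis using 1 by simp
qed

lemma (in orthant_measure) integrable_exp_inner:
  assumes "s \<in> neg_orthant"
  shows "integrable M (\<lambda>u. exp (s \<bullet> u))"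
    and "laplace M (cvec s) = of_real (\<integral>u. exp (s \<bullet> u) \<partial>M)"
proof -
  have "integrable M (\<lambda>u. exp (cdot (cvec s) u))"
    using assms by (intro integrable_exp_cdot) (auto simp: cvec_def neg_orthant_def less_imp_le)
  then have "integrable M (\<lambda>u. complex_of_real (exp (s \<bullet> u)))" by (simp add: cdot_cvec exp_of_real)
  then show "integrable M (\<lambda>u. exp (s \<bullet> u))" by (simp only: complex_of_real_integrable_eq)
  show "laplace M (cvec s) = of_real (\<integral>u. exp (s \<bullet> u) \<partial>M)"
    unfolding laplace_def integral_complex_of_real[symmetric] by (simp add: cdot_cvec exp_of_real)
qed

text \<open>The pointwise bound \<open>norm_exp_minus_1_le\<close> is integrated with
  \<open>x = r * (\<Sum>j\<in>UNIV. u $ j)\<close>, which is minus the pairing of \<open>u\<close>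
  with the diagonal point. It controls the transform at every \<open>z\<close> of size at most
  \<open>r\<close> by one real value.\<close>

lemma (in orthant_measure) norm_laplace_minus_1_le:
  assumes M: "measure M UNIV = 1" and z: "z \<in> Pi_minus" and r: "max_norm z \<le> r" "0 < r"
  shows "cmod (laplace M z - 1) \<le> 3 * \<bar>(\<integral>u. exp ((\<chi> j. - r) \<bullet> u) \<partial>M) - 1\<bar>"
proof -
  let ?s = "(\<chi> j. - r) :: real ^ 'n"
  have s: "?s \<in> neg_orthant" using r(2) by (simp add: neg_orthant_def)
  have Re_z: "Re (z $ j) \<le> 0" for j using z by (auto simp: Pi_minus_def less_imp_le)
  have int: "integrable M (\<lambda>u. exp (cdot z u))" using Re_z by (rule integrable_exp_cdot)
  have "laplace M z - 1 = (\<integral>u. exp (cdot z u) - 1 \<partial>M)"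
    using int M by (simp add: laplace_def)
  then have "cmod (laplace M z - 1) \<le> (\<integral>u. cmod (exp (cdot z u) - 1) \<partial>M)"
    by (simp add: integral_norm_bound)
  also have "\<dots> \<le> (\<integral>u. 3 * (1 - exp (?s \<bullet> u)) \<partial>M)"
  proof (rule integral_mono_AE)
    show "AE u in M. cmod (exp (cdot z u) - 1) \<le> 3 * (1 - exp (?s \<bullet> u))"
      using AE_orthant
    proof eventually_elim
      case (elim u)
      have inner: "?s \<bullet> u = - (r * (\<Sum>j\<in>UNIV. u $ j))"
        by (simp add: inner_vec_def sum_negf sum_distrib_left)
      have "max_norm z * (\<Sum>j\<in>UNIV. u $ j) \<le> r * (\<Sum>j\<in>UNIV. u $ j)"
        using elim r(1) by (intro mult_right_mono sum_nonneg) (auto simp: nonneg_orthant_def)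
      then have "cmod (cdot z u) \<le> r * (\<Sum>j\<in>UNIV. u $ j)" using norm_cdot_le[OF elim, of z] by simp
      moreover have "Re (cdot z u) \<le> 0" using Re_cdot_le[OF elim Re_z] by simp
      ultimately show ?case unfolding inner by (intro norm_exp_minus_1_le)
    qed
  qed (use int integrable_exp_inner(1)[OF s] in auto)
  also have "\<dots> = 3 * (1 - (\<integral>u. exp (?s \<bullet> u) \<partial>M))"
    using integrable_exp_inner(1)[OF s] M by simp
  also have "\<dots> \<le> 3 * \<bar>(\<integral>u. exp (?s \<bullet> u) \<partial>M) - 1\<bar>" by (rule mult_left_mono) auto
  finally show ?thesis .
qed

text \<open>The equality case of the norm bound: \<open>exp (cdot z u)\<close> must have modulus 1
  almost everywhere. As the real parts of \<open>z\<close> are bounded away from 0, this forces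
  \<open>u = 0\<close>, so the measure is concentrated at the origin.\<close>

lemma (in orthant_measure) laplace_eq_1:
  assumes M: "measure M UNIV = 1" and z: "z \<in> Pi_minus" and eq: "cmod (laplace M z) = 1"
  shows "laplace M w = 1"
proof -
  obtain e where e: "e > 0" "\<And>j. Re (z $ j) \<le> - e"
    using Pi_minus_uniform[OF z, where thesis = thesis] by blast
  have Re_z: "Re (z $ j) \<le> 0" for j using e(1) e(2)[of j] by simp
  have int: "integrable M (\<lambda>u. exp (cdot z u))" using Re_z by (rule integrable_exp_cdot)
  have ae: "AE u in M. 0 \<le> 1 - cmod (exp (cdot z u))"
    using AE_norm_exp_cdot[OF Re_z] by eventually_elim simp
  have "1 \<le> (\<integral>u. cmod (exp (cdot z u)) \<partial>M)"
    using integral_norm_bound[of M "\<lambda>u. exp (cdot z u)"] eq by (simp add: laplace_def)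
  then have "(\<integral>u. 1 - cmod (exp (cdot z u)) \<partial>M) \<le> 0"
    using integrable_norm[OF int] M by (subst Bochner_Integration.integral_diff) auto
  moreover have "0 \<le> (\<integral>u. 1 - cmod (exp (cdot z u)) \<partial>M)" by (rule integral_nonneg_AE[OF ae])
  ultimately have "(\<integral>u. 1 - cmod (exp (cdot z u)) \<partial>M) = 0" by linarith
  then have "AE u in M. 1 - cmod (exp (cdot z u)) = 0"
    using integrable_norm[OF int] ae by (subst (asm) integral_nonneg_eq_0_iff_AE) auto
  with AE_orthant have "AE u in M. u = 0"
  proof eventually_elim
    case (elim u)
    have "0 \<le> - (e * (\<Sum>j\<in>UNIV. u $ j))" using Re_cdot_le[OF elim(1) e(2)] elim(2) by simp
    then have "(\<Sum>j\<in>UNIV. u $ j) \<le> 0" using e(1) by (simp add: mult_le_0_iff)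
    moreover have "0 \<le> u $ j" for j using elim(1) by (simp add: nonneg_orthant_def)
    ultimately have "\<forall>j\<in>UNIV. u $ j = 0"
      by (subst sum_nonneg_eq_0_iff[symmetric]) (auto intro!: antisym sum_nonneg)
    then show ?case by (simp add: vec_eq_iff)
  qed
  then have "laplace M w = (\<integral>u. 1 \<partial>M)"
    unfolding laplace_def by (intro integral_cong_AE) (auto simp: cdot_def elim!: eventually_mono)
  then show ?thesis using M by simp
qed

section \<open>Total variation distance and integrals\<close>

context orthant_measure
begin

text \<open>This makes \<open>Abs_bmeasure\<close> invertible in \<open>bmeasure_of_measure\<close>;
  the total mass bounds all partition sums.\<close>

lemma bounded_cmeasure_measure:
  "bounded_cmeasure (\<lambda>A. if A \<in> orthant_borel then of_real (measure M A) else 0)"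
  unfolding bounded_cmeasure_def
proof (intro conjI allI impI)
  fix F :: "nat \<Rightarrow> (real ^ 'n) set"
  assume F: "range F \<subseteq> orthant_borel" "disjoint_family F"
  then have "(\<Union>i. F i) \<in> orthant_borel" "\<And>i. F i \<in> orthant_borel" by (auto simp: orthant_borel_def)
  moreover have "(\<lambda>i. measure M (F i)) sums measure M (\<Union>i. F i)"
    using F by (intro finite_measure_UNION) (auto simp: orthant_borel_def sets_M)
  ultimately show "(\<lambda>i. if F i \<in> orthant_borel then complex_of_real (measure M (F i)) else 0) sums
      (if \<Union> (range F) \<in> orthant_borel then complex_of_real (measure M (\<Union> (range F))) else 0)"
    by (simp add: sums_of_real)
next
  show "bdd_above ((\<lambda>P. \<Sum>A\<in>P. cmod (if A \<in> orthant_borel then of_real (measure M A) else 0))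
      ` orthant_partitions)"
  proof (rule bdd_aboveI2)
    fix P :: "(real ^ 'n) set set" assume P: "P \<in> orthant_partitions"
    have "(\<Sum>A\<in>P. cmod (if A \<in> orthant_borel then of_real (measure M A) else 0)) = (\<Sum>A\<in>P. measure M A)"
      using P by (intro sum.cong) (auto simp: orthant_partitions_def)
    also have "\<dots> = measure M (\<Union>A\<in>P. A)"
      using P by (intro finite_measure_finite_Union[symmetric])
        (auto simp: orthant_partitions_def orthant_borel_def sets_M disjoint_family_on_def disjoint_def)
    also have "\<dots> \<le> measure M UNIV" using bounded_measure by simp
    finally show "(\<Sum>A\<in>P. cmod (if A \<in> orthant_borel then of_real (measure M A) else 0)) \<le> measure M UNIV" .
  qed
qed simp

text \<open>The value 0 is left out because, for a function vanishing off the orthant, the remaining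
  level sets lie inside it and so form an admissible partition.\<close>

lemma integral_simple_function:
  assumes F: "simple_function borel F"
  shows "integral\<^sup>L M F = (\<Sum>y\<in>range F - {0}. measure M (F -` {y}) *\<^sub>R (y :: complex))"
proof -
  have fin: "finite (range F)" using simple_functionD(1)[OF F] by simp
  have meas: "F -` {y} \<in> sets M" for y using simple_functionD(2)[OF F, of "{y}"] by (simp add: sets_M)
  have F_eq: "F x = (\<Sum>y\<in>range F - {0}. indicator (F -` {y}) x *\<^sub>R y)" for x
  proof -
    have "(\<Sum>y\<in>range F - {0}. indicator (F -` {y}) x *\<^sub>R y) = (\<Sum>y\<in>range F - {0}. if y = F x then y else 0)"
      by (intro sum.cong) (auto simp: indicator_def)
    then show ?thesis using fin by simp
  qed
  have "integral\<^sup>L M F = (\<integral>x. (\<Sum>y\<in>range F - {0}. indicator (F -` {y}) x *\<^sub>R y) \<partial>M)"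
    by (rule Bochner_Integration.integral_cong[OF refl F_eq])
  also have "\<dots> = (\<Sum>y\<in>range F - {0}. (\<integral>x. indicator (F -` {y}) x *\<^sub>R y \<partial>M))"
    using meas by (intro Bochner_Integration.integral_sum integrable_scaleR_left)
      (auto simp: integrable_real_indicator emeasure_eq_measure)
  also have "\<dots> = (\<Sum>y\<in>range F - {0}. measure M (F -` {y}) *\<^sub>R y)"
    using meas by (intro sum.cong refl)
      (subst integral_scaleR_left, auto simp: emeasure_eq_measure integrable_real_indicator)
  finally show ?thesis .
qed

end

lemma bmeasure_partition_bound:
  assumes M: "orthant_measure M" and N: "orthant_measure N" and P: "P \<in> orthant_partitions"
  shows "(\<Sum>A\<in>P. \<bar>measure M A - measure N A\<bar>) \<le> norm (bmeasure_of_measure M - bmeasure_of_measure N)"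
proof -
  let ?d = "bmeasure_of_measure M - bmeasure_of_measure N"
  have "bmeasure_of ?d A = of_real (measure M A - measure N A)" if "A \<in> orthant_borel" for A
    using that
    unfolding minus_bmeasure_def plus_bmeasure.rep_eq uminus_bmeasure.rep_eq
    by (simp add: bmeasure_of_measure_def Abs_bmeasure_inverse orthant_measure.bounded_cmeasure_measure[OF M]
        orthant_measure.bounded_cmeasure_measure[OF N])
  moreover have "P \<subseteq> orthant_borel" using P by (simp add: orthant_partitions_def)
  ultimately have "(\<Sum>A\<in>P. \<bar>measure M A - measure N A\<bar>) = (\<Sum>A\<in>P. cmod (bmeasure_of ?d A))"
    by (intro sum.cong refl) (metis norm_of_real subsetD)
  also have "\<dots> \<le> tv_norm (bmeasure_of ?d)"
    using bmeasure_of[of ?d] P by (intro bounded_cmeasure_bound) auto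
  finally show ?thesis by (simp add: norm_bmeasure.rep_eq)
qed

text \<open>For simple functions the difference of integrals is a weighted partition sum of the
  difference of measures; dominated convergence does the rest. The factor 2 comes from the bound on
  the approximating simple functions.\<close>

lemma norm_integral_diff_le:
  fixes M N :: "(real ^ 'n) measure" and f :: "real ^ 'n \<Rightarrow> complex"
  assumes M: "orthant_measure M" and N: "orthant_measure N"
    and f: "f \<in> borel_measurable borel" "\<And>u. u \<in> nonneg_orthant \<Longrightarrow> cmod (f u) \<le> 1"
  shows "cmod (integral\<^sup>L M f - integral\<^sup>L N f)
           \<le> 2 * norm (bmeasure_of_measure M - bmeasure_of_measure N)"
proof -
  interpret M: orthant_measure M by fact
  interpret N: orthant_measure N by fact
  note [measurable] = f(1) M.orthant_sets
  define g where "g u = indicator nonneg_orthant u *\<^sub>R f u" for u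
  have g: "g \<in> borel_measurable borel" unfolding g_def by measurable
  \<comment> \<open>Domination by twice the modulus of \<open>g\<close> gives both the uniform bound
    2 and vanishing off the orthant, which is why \<open>f\<close> was cut off first.\<close>
  obtain F where F: "\<And>i. simple_function borel (F i)" "\<And>x. (\<lambda>i. F i x) \<longlonglongrightarrow> g x"
    "\<And>i x. dist (F i x) 0 \<le> 2 * dist (g x) 0"
    using borel_measurable_implies_sequence_metric[OF g, of 0] by (auto simp: space_borel)
  have F_le: "cmod (F i x) \<le> 2" for i x
    using F(3)[of i x] f(2)[of x] by (cases "x \<in> nonneg_orthant") (auto simp: g_def)
  have F_0: "F i x = 0" if "x \<notin> nonneg_orthant" for i x
    using F(3)[of i x] that by (simp add: g_def)
  have lim: "(\<lambda>i. integral\<^sup>L L (F i)) \<longlonglongrightarrow> integral\<^sup>L L f" if "orthant_measure L" for L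
  proof -
    interpret L: orthant_measure L by fact
    have "(\<lambda>i. integral\<^sup>L L (F i)) \<longlonglongrightarrow> integral\<^sup>L L g"
    proof (rule integral_dominated_convergence[where w = "\<lambda>_. 2"])
      show "F i \<in> borel_measurable L" for i
        using borel_measurable_simple_function[OF F(1)] by (simp add: measurable_cong_sets[OF L.sets_M refl])
    qed (use F F_le g in \<open>simp_all add: measurable_cong_sets[OF L.sets_M refl]\<close>)
    also have "integral\<^sup>L L g = integral\<^sup>L L f"
    proof (rule integral_cong_AE)
      show "AE u in L. g u = f u" using L.AE_orthant by eventually_elim (simp add: g_def)
    qed (use f(1) g in \<open>simp_all add: measurable_cong_sets[OF L.sets_M refl]\<close>)
    finally show ?thesis .
  qed
  show ?thesis
  proof (rule tendsto_upperbound[OF tendsto_norm[OF tendsto_diff[OF lim[OF M] lim[OF N]]]])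
    show "\<forall>\<^sub>F i in sequentially. cmod (integral\<^sup>L M (F i) - integral\<^sup>L N (F i))
        \<le> 2 * norm (bmeasure_of_measure M - bmeasure_of_measure N)"
    proof (rule always_eventually, rule allI)
      fix i
      let ?R = "range (F i) - {0}" and ?A = "\<lambda>y. F i -` {y}"
      have fin: "finite ?R" using simple_functionD(1)[OF F(1)] by simp
      \<comment> \<open>Injectivity allows the sum over values to be rewritten as a sum over level
        sets.\<close>
      have inj: "inj_on ?A ?R" by (auto simp: inj_on_def)
      have "?A y \<in> orthant_borel" if "y \<in> ?R" for y
        using that simple_functionD(2)[OF F(1), of i "{y}"] F_0[of _ i]
        by (auto simp: orthant_borel_def space_borel)
      then have P: "?A ` ?R \<in> orthant_partitions"
        using fin by (auto simp: orthant_partitions_def disjoint_def)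
      have "cmod (integral\<^sup>L M (F i) - integral\<^sup>L N (F i))
          = cmod (\<Sum>y\<in>?R. (measure M (?A y) - measure N (?A y)) *\<^sub>R y)"
        by (simp add: M.integral_simple_function[OF F(1)] N.integral_simple_function[OF F(1)]
            sum_subtractf scaleR_left_diff_distrib)
      also have "\<dots> \<le> (\<Sum>y\<in>?R. \<bar>measure M (?A y) - measure N (?A y)\<bar> * 2)"
        using F_le by (intro order_trans[OF norm_sum] sum_mono) (auto intro!: mult_left_mono)
      also have "\<dots> = 2 * (\<Sum>A\<in>?A ` ?R. \<bar>measure M A - measure N A\<bar>)"
        by (simp add: sum.reindex[OF inj] sum_distrib_left mult.commute)
      also have "\<dots> \<le> 2 * norm (bmeasure_of_measure M - bmeasure_of_measure N)"
        using bmeasure_partition_bound[OF M N P] by simp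
      finally show "cmod (integral\<^sup>L M (F i) - integral\<^sup>L N (F i))
          \<le> 2 * norm (bmeasure_of_measure M - bmeasure_of_measure N)" .
    qed
  qed simp
qed

text \<open>A bound between increments passes to the limit of the difference quotients. The set
  \<open>S\<close> admits one-sided derivatives, used below at time 0.\<close>

lemma vector_derivative_norm_le:
  assumes f: "(f has_vector_derivative f') (at t within S)" and g: "(g has_vector_derivative g') (at t within S)"
    and S: "at t within S \<noteq> bot"
    and le: "\<forall>\<^sub>F s in at t within S. norm (g s - g t) \<le> C * norm (f s - f t)"
  shows "norm g' \<le> C * norm f'"
proof -
  have lim: "((\<lambda>s. norm (k s - k t) / \<bar>s - t\<bar>) \<longlongrightarrow> norm k') (at t within S)"
    if "(k has_vector_derivative k') (at t within S)" for k :: "real \<Rightarrow> 'c::real_normed_vector" and k'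
  proof -
    have "((\<lambda>s. norm (k s - k t - (s - t) *\<^sub>R k') / norm (s - t)) \<longlongrightarrow> 0) (at t within S)"
      using that by (simp add: has_vector_derivative_def has_derivative_iff_norm)
    moreover have "\<forall>\<^sub>F s in at t within S. norm (k s - k t - (s - t) *\<^sub>R k') / norm (s - t)
        = norm ((k s - k t) /\<^sub>R (s - t) - k')"
      unfolding eventually_at_filter
    proof (intro always_eventually allI impI)
      fix s assume "s \<noteq> t"
      then have "(k s - k t) /\<^sub>R (s - t) - k' = (k s - k t - (s - t) *\<^sub>R k') /\<^sub>R (s - t)"
        by (simp add: scaleR_diff_right)
      then show "norm (k s - k t - (s - t) *\<^sub>R k') / norm (s - t)
          = norm ((k s - k t) /\<^sub>R (s - t) - k')"
        by (simp add: divide_inverse mult.commute)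
    qed
    ultimately have "((\<lambda>s. norm ((k s - k t) /\<^sub>R (s - t) - k')) \<longlongrightarrow> 0) (at t within S)"
      by (simp add: tendsto_cong)
    then have "((\<lambda>s. (k s - k t) /\<^sub>R (s - t)) \<longlongrightarrow> k') (at t within S)"
      by (simp add: LIM_zero_iff tendsto_norm_zero_iff)
    from tendsto_norm[OF this] show ?thesis by (simp add: divide_inverse mult.commute)
  qed
  show ?thesis
  proof (rule tendsto_le[OF S tendsto_mult[OF tendsto_const lim[OF f]] lim[OF g]])
    show "\<forall>\<^sub>F s in at t within S. norm (g s - g t) / \<bar>s - t\<bar> \<le> C * (norm (f s - f t) / \<bar>s - t\<bar>)"
      using le by eventually_elim (simp add: divide_right_mono)
  qed
qed

section \<open>Growth of functions from a half-plane to a sector\<close>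

text \<open>The Cayley map \<open>\<phi>\<close> carries the disc to the right half-plane, and
  \<open>H\<close> brings \<open>G\<close> back to the disc, normalised to fix 0. The Schwarz lemma
  then compares \<open>(b - a) / (b + a)\<close> with \<open>(r - 1) / (r + 1)\<close>.\<close>

lemma half_plane_linear_growth:
  assumes G: "G holomorphic_on {z. Re z > 0}" and pos: "\<And>z. Re z > 0 \<Longrightarrow> Re (G z) > 0"
    and a: "G 1 = of_real a" and b: "G (of_real r) = of_real b" and r: "r \<ge> 1"
  shows "b \<le> a * r"
proof -
  define \<phi> :: "complex \<Rightarrow> complex" where "\<phi> w = (1 + w) / (1 - w)" for w
  define H where "H w = (G (\<phi> w) - of_real a) / (G (\<phi> w) + of_real a)" for w
  have a0: "a > 0" using pos[of 1] a by simp
  have b0: "b > 0" using pos[of "of_real r"] b r by simp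
  have \<phi>: "Re (\<phi> w) > 0" if "cmod w < 1" for w
  proof -
    have "w \<noteq> 1" using that by auto
    have "(cmod w)\<^sup>2 < 1" using that by (simp add: abs_square_less_1)
    then have "(Re w)\<^sup>2 + (Im w)\<^sup>2 < 1" by (simp add: cmod_power2)
    \<comment> \<open>This real part equals \<open>1 - (cmod w)\<^sup>2\<close>.\<close>
    then have "Re ((1 + w) * cnj (1 - w)) > 0" by (simp add: algebra_simps power2_eq_square)
    moreover have "\<phi> w = (1 + w) * cnj (1 - w) / of_real ((cmod (1 - w))\<^sup>2)"
      unfolding \<phi>_def by (rule complex_div_cnj[THEN trans]) simp
    ultimately show ?thesis using \<open>w \<noteq> 1\<close>
      by (simp only: Re_divide_of_real) (simp add: zero_less_divide_iff)
  qed
  \<comment> \<open>The chosen point is the preimage of \<open>r\<close> under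
    \<open>\<phi>\<close>; \<open>H 0 = 0\<close> because \<open>\<phi>\<close> sends 0 to 1, where
    \<open>G\<close> equals \<open>a\<close>.\<close>
  have "cmod (H (of_real ((r - 1) / (r + 1)))) \<le> cmod (of_real ((r - 1) / (r + 1)))"
  proof (rule Schwarz_Lemma(1))
    have "(\<lambda>w. G (\<phi> w)) holomorphic_on ball 0 1"
    proof (rule holomorphic_on_compose_gen[OF _ G, unfolded comp_def])
      show "\<phi> holomorphic_on ball 0 1" unfolding \<phi>_def by (intro holomorphic_intros) auto
    qed (use \<phi> in auto)
    moreover have "G (\<phi> w) + of_real a \<noteq> 0" if "w \<in> ball 0 1" for w
      using pos[OF \<phi>[of w]] that a0 by (auto simp: complex_eq_iff)
    ultimately show "H holomorphic_on ball 0 1"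
      unfolding H_def by (intro holomorphic_intros)
    show "H 0 = 0" by (simp add: H_def \<phi>_def a)
    show "cmod (H w) < 1" if "cmod w < 1" for w
    proof -
      let ?g = "G (\<phi> w)"
      have g: "Re ?g > 0" using pos[OF \<phi>[OF that]] .
      have "(cmod (?g - of_real a))\<^sup>2 < (cmod (?g + of_real a))\<^sup>2"
        using mult_pos_pos[OF a0 g] unfolding cmod_power2 by (simp add: power2_eq_square algebra_simps)
      then have "cmod (?g - of_real a) < cmod (?g + of_real a)" by (rule power_less_imp_less_base) simp
      then show ?thesis unfolding H_def norm_divide by (simp add: divide_less_eq)
    qed
    have "\<bar>(r - 1) / (r + 1)\<bar> < 1" using r by simp
    then show "cmod (of_real ((r - 1) / (r + 1))) < 1" unfolding norm_of_real .
  qed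
  moreover have "\<phi> (of_real ((r - 1) / (r + 1))) = of_real r"
  proof -
    have "(1 + (r - 1) / (r + 1)) / (1 - (r - 1) / (r + 1)) = r" using r by (simp add: field_simps)
    then show ?thesis unfolding \<phi>_def by (metis of_real_1 of_real_add of_real_diff of_real_divide)
  qed
  ultimately have "cmod (of_real ((b - a) / (b + a))) \<le> cmod (of_real ((r - 1) / (r + 1)))"
    by (simp add: H_def b)
  then have "\<bar>b - a\<bar> / (b + a) \<le> (r - 1) / (r + 1)"
    unfolding norm_of_real using a0 b0 r by (simp add: abs_divide)
  moreover have "(b - a) / (b + a) \<le> \<bar>b - a\<bar> / (b + a)" using a0 b0 by (simp add: divide_right_mono)
  ultimately have "(b - a) / (b + a) \<le> (r - 1) / (r + 1)" by linarith
  then show ?thesis using a0 b0 r by (simp add: field_simps)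
qed

text \<open>The power \<open>p = pi / (2 * \<theta>)\<close> maps the sector into the right
  half-plane, where growth is at most linear; the root of order \<open>p\<close> gives the exponent.
  Positivity of \<open>Re (F z)\<close> keeps \<open>F z\<close> off the branch cut.\<close>

lemma half_plane_sector_growth:
  assumes F: "F holomorphic_on {z. Re z > 0}" and pos: "\<And>z. Re z > 0 \<Longrightarrow> Re (F z) > 0"
    and Arg: "\<And>z. Re z > 0 \<Longrightarrow> \<bar>Arg (F z)\<bar> < \<theta>" and \<theta>: "0 < \<theta>"
    and a: "F 1 = of_real a" and b: "F (of_real r) = of_real b" and r: "r \<ge> 1"
  shows "b \<le> a * r powr (2 * \<theta> / pi)"
proof -
  define p where "p = pi / (2 * \<theta>)"
  have p: "p > 0" using \<theta> by (simp add: p_def)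
  have a0: "a > 0" using pos[of 1] a by simp
  have b0: "b > 0" using pos[of "of_real r"] b r by simp
  have "b powr p \<le> a powr p * r"
  proof (rule half_plane_linear_growth)
    show "(\<lambda>z. F z powr of_real p) holomorphic_on {z. Re z > 0}"
    proof (intro holomorphic_intros F)
      show "F z \<notin> \<real>\<^sub>\<le>\<^sub>0" if "z \<in> {z. Re z > 0}" for z
        using pos[of z] that by (auto simp: complex_nonpos_Reals_iff)
    qed
    show "Re (F z powr of_real p) > 0" if z: "Re z > 0" for z
    proof -
      have F0: "F z \<noteq> 0" using pos[OF z] by auto
      have "\<bar>p * Arg (F z)\<bar> < p * \<theta>" using Arg[OF z] p by (simp add: abs_mult)
      also have "p * \<theta> = pi / 2" using \<theta> by (simp add: p_def)
      finally have "cos (p * Arg (F z)) > 0" by (intro cos_gt_zero_pi) auto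
      then show ?thesis using F0 by (simp add: powr_def Re_exp Arg_eq_Im_Ln)
    qed
    show "F 1 powr of_real p = of_real (a powr p)" using a a0 by (simp add: powr_of_real)
    show "F (of_real r) powr of_real p = of_real (b powr p)" using b b0 by (simp add: powr_of_real)
  qed (rule r)
  then have "(b powr p) powr (1 / p) \<le> (a powr p * r) powr (1 / p)"
    using p by (intro powr_mono2) auto
  then have "b \<le> a * r powr (1 / p)" using a0 b0 r p by (simp add: powr_mult powr_powr)
  then show ?thesis by (simp add: p_def)
qed

lemma abs_Arg_less_arctan:
  assumes "Re z > 0" "\<bar>Im z\<bar> < m * Re z"
  shows "\<bar>Arg z\<bar> < arctan m"
proof -
  have "Arg z = arctan (Im z / Re z)" using assms(1) by (rule arg_conv_arctan)
  moreover have "- m < Im z / Re z" "Im z / Re z < m" using assms by (auto simp: field_simps)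
  ultimately show ?thesis
    using arctan_less_iff[of "Im z / Re z" m] arctan_less_iff[of "- m" "Im z / Re z"] by (simp add: arctan_minus abs_less_iff)
qed

section \<open>Range and growth of the symbol\<close>

theorem theorem4p1:
  fixes \<psi> :: "real ^ 'n \<Rightarrow> real"
    and \<Psi> :: "complex ^ 'n \<Rightarrow> complex"
    and \<nu> :: "real \<Rightarrow> (real ^ 'n) measure"
  assumes "\<psi> \<in> T0_class"
    and "symbol_extension \<psi> \<Psi>"
    and "convolution_semigroup \<nu>"
    and "\<And>t s. 0 \<le> t \<Longrightarrow> s \<in> neg_orthant \<Longrightarrow> (\<integral>u. exp (s \<bullet> u) \<partial>\<nu> t) = exp (t * \<psi> s)"
    and a: "\<And>(X :: 'x::complex_banach set) (T :: 'n \<Rightarrow> real \<Rightarrow> 'x \<Rightarrow> 'x).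
      closed_csubspace X \<Longrightarrow> (\<And>j. bounded_C0_semigroup X (T j)) \<Longrightarrow> commuting_on X T \<Longrightarrow>
      yosida X (subordinate \<nu> T)"
    and b: "yosida UNIV (\<lambda>t. Z_op (\<nu> t))"
    and c: "\<exists>\<nu>'. (\<forall>t>0. ((\<lambda>t. bmeasure_of_measure (\<nu> t)) has_vector_derivative \<nu>' t) (at t)) \<and>
      continuous_on {0<..} \<nu>' \<and> (\<lambda>t. norm (\<nu>' t)) \<in> O[at_right 0](\<lambda>t. 1 / t)"
  shows "((\<exists>z\<in>Pi_minus. \<Psi> z \<noteq> 0) \<longrightarrow>
      (\<exists>\<theta> \<beta>. 0 < \<theta> \<and> 2 * \<theta> < pi \<and> 0 < \<beta> \<and> \<Psi> ` Pi_minus \<subseteq> truncated_sector \<theta> \<beta>)) \<and>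
    (\<exists>K \<gamma>. 0 < K \<and> 0 < \<gamma> \<and> \<gamma> < 1 \<and>
      (\<forall>z\<in>closure Pi_minus. 1 \<le> max_norm z \<longrightarrow> cmod (\<Psi> z) \<le> K * max_norm z powr \<gamma>))"
proof -

  \<comment> \<open>Laplace transforms of the semigroup and the sign of the real part\<close>
  have meas: "orthant_measure (\<nu> t)" "measure (\<nu> t) UNIV = 1" if "0 \<le> t" for t
  proof -
    have \<nu>: "prob_space (\<nu> t)" "sets (\<nu> t) = sets borel" "emeasure (\<nu> t) (- nonneg_orthant) = 0"
      using assms(3) that by (auto simp: convolution_semigroup_def)
    interpret prob_space "\<nu> t" by fact
    show "orthant_measure (\<nu> t)" by unfold_locales (use \<nu> in auto)
    show "measure (\<nu> t) UNIV = 1" using prob_space sets_eq_imp_space_eq[OF \<nu>(2)] by simp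
  qed
  have hol: "holomorphic_vec \<Psi> Pi_minus" and cont: "continuous_on (closure Pi_minus) \<Psi>"
    and real: "\<And>s. s \<in> neg_orthant \<Longrightarrow> \<Psi> (cvec s) = of_real (\<psi> s)"
    using assms(2) by (auto simp: symbol_extension_def)
  have lap: "laplace (\<nu> t) z = exp (of_real t * \<Psi> z)" if "0 \<le> t" "z \<in> Pi_minus" for t z
  proof (rule laplace_eqI[OF meas(1)[OF that(1)] hol _ that(2)])
    fix s :: "real ^ 'n" assume s: "s \<in> neg_orthant"
    then show "laplace (\<nu> t) (cvec s) = exp (of_real t * \<Psi> (cvec s))"
      using orthant_measure.integrable_exp_inner(2)[OF meas(1)[OF that(1)] s] assms(4)[OF that(1) s]
      by (simp add: real flip: exp_of_real)
  qed
  have Re_le: "Re (\<Psi> z) \<le> 0" if "z \<in> Pi_minus" for z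
  proof -
    have "cmod (laplace (\<nu> 1) z) \<le> 1"
      using orthant_measure.norm_laplace_le[OF meas(1), of 1 z] meas(2)[of 1] that
      by (simp add: Pi_minus_def less_imp_le)
    then show ?thesis using lap[OF _ that, of 1] by simp
  qed
  have deriv: "((\<lambda>t. exp (of_real t * w)) has_vector_derivative w * exp (of_real t * w)) (at t within S)"
    for w :: complex and t S
  proof -
    have "((\<lambda>x. exp (x * w)) has_field_derivative w * exp (of_real t * w)) (at (of_real t))"
      by (auto intro!: derivative_eq_intros)
    then show ?thesis
      using has_vector_derivative_real_field by (blast intro: has_vector_derivative_at_within)
  qed
  \<comment> \<open>The open half-plane in \<open>truncated_sector\<close> demands strictness. A
    zero of the real part would concentrate every \<open>\<nu> t\<close> at the origin and so make
    \<open>\<Psi>\<close> vanish throughout \<open>Pi_minus\<close>.\<close>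
  have Re_less: "Re (\<Psi> z) < 0" if nz: "\<exists>z\<in>Pi_minus. \<Psi> z \<noteq> 0" and z: "z \<in> Pi_minus" for z
  proof (rule ccontr)
    assume "\<not> Re (\<Psi> z) < 0"
    then have "Re (\<Psi> z) = 0" using Re_le[OF z] by simp
    then have "cmod (laplace (\<nu> t) z) = 1" if "0 \<le> t" for t
      using lap[OF that z] by simp
    then have lap_1: "laplace (\<nu> t) w = 1" if "0 \<le> t" for t w
      using orthant_measure.laplace_eq_1[OF meas(1) meas(2) z] that by blast
    obtain w where w: "w \<in> Pi_minus" "\<Psi> w \<noteq> 0" using nz by blast
    \<comment> \<open>The transforms at \<open>w\<close> are constantly 1, so the exponential curve
      has the increments of the zero curve and its right derivative \<open>\<Psi> w\<close> at time
      0 vanishes.\<close>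
    have "((\<lambda>_. 0 :: real) has_vector_derivative 0) (at 0 within {0<..})" by simp
    moreover have "((\<lambda>t. exp (of_real t * \<Psi> w)) has_vector_derivative \<Psi> w) (at 0 within {0<..})"
      using deriv[of "\<Psi> w" 0] by simp
    ultimately have "norm (\<Psi> w) \<le> 1 * norm (0 :: real)"
    proof (rule vector_derivative_norm_le)
      show "\<forall>\<^sub>F t in at 0 within {0<..}. norm (exp (of_real t * \<Psi> w) - exp (of_real 0 * \<Psi> w)) \<le> 1 * norm (0 - 0 :: real)"
        using eventually_at_right_less[of "0 :: real"]
        by eventually_elim (use lap[OF _ w(1)] lap_1 in simp)
    qed simp
    with w(2) show False by simp
  qed

  \<comment> \<open>The sector condition from the derivative bound\<close>
  obtain \<nu>' where \<nu>': "\<And>t. 0 < t \<Longrightarrow> ((\<lambda>t. bmeasure_of_measure (\<nu> t)) has_vector_derivative \<nu>' t) (at t)"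
    and bigo: "(\<lambda>t. norm (\<nu>' t)) \<in> O[at_right 0](\<lambda>t. 1 / t)"
    using c by blast
  obtain k where k: "k > 0" "\<forall>\<^sub>F t in at_right 0. norm (norm (\<nu>' t)) \<le> k * norm (1 / t)"
    using bigo by (rule landau_o.bigE)
  then obtain \<delta> where \<delta>: "\<delta> > 0" "\<And>t. 0 < t \<Longrightarrow> t < \<delta> \<Longrightarrow> norm (\<nu>' t) \<le> k / t"
    by (auto simp: eventually_at_right_field)
  have diff: "cmod (\<Psi> z * exp (of_real t * \<Psi> z)) \<le> 2 * norm (\<nu>' t)" if t: "0 < t" and z: "z \<in> Pi_minus" for t z
  proof (rule vector_derivative_norm_le[OF \<nu>'[OF t] deriv])
    have "\<forall>\<^sub>F s in at t. 0 < s" using t by (intro order_tendstoD(1)[OF tendsto_ident_at])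
    then show "\<forall>\<^sub>F s in at t. cmod (exp (of_real s * \<Psi> z) - exp (of_real t * \<Psi> z))
        \<le> 2 * norm (bmeasure_of_measure (\<nu> s) - bmeasure_of_measure (\<nu> t))"
    proof eventually_elim
      case (elim s)
      have "cmod (exp (cdot z u)) \<le> 1" if "u \<in> nonneg_orthant" for u
        using Re_cdot_le[OF that, of z 0] z by (simp add: Pi_minus_def less_imp_le)
      then show ?case
        using norm_integral_diff_le[OF meas(1) meas(1), of s t "\<lambda>u. exp (cdot z u)"] t elim lap[OF _ z]
        by (simp add: laplace_def)
    qed
  qed simp
  \<comment> \<open>The choice of \<open>\<beta>\<close> gives
    \<open>1 / \<beta> = \<delta> / 2\<close>, which keeps the time \<open>t\<close> used below
    inside the range of the bound on \<open>\<nu>'\<close>. The added 1 in \<open>m\<close> makes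
    the slope inequality strict.\<close>
  define \<beta> m where "\<beta> = 2 / \<delta>" and "m = 2 * k * exp 1 + 1"
  define \<theta> where "\<theta> = arctan m"
  have \<beta>: "0 < \<beta>" using \<delta>(1) by (simp add: \<beta>_def)
  have m: "0 < m" using k(1) by (simp add: m_def add_pos_pos)
  have \<theta>: "0 < \<theta>" "2 * \<theta> < pi"
    using m arctan_ubound[of m] by (auto simp: \<theta>_def)
  have Arg: "\<bar>Arg (of_real \<beta> - \<Psi> z)\<bar> < \<theta>" if z: "z \<in> Pi_minus" for z
  proof -
    let ?w = "\<Psi> z" and ?r = "Re (of_real \<beta> - \<Psi> z)"
    have r: "\<beta> \<le> ?r" using Re_le[OF z] by simp
    then have r0: "0 < ?r" using \<beta> by linarith
    define t where "t = 1 / ?r"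
    have t: "0 < t" using r0 by (simp add: t_def)
    have "t \<le> 1 / \<beta>" unfolding t_def using r \<beta> by (intro divide_left_mono) auto
    also have "1 / \<beta> < \<delta>" using \<delta>(1) by (simp add: \<beta>_def)
    finally have t\<delta>: "t < \<delta>" .
    \<comment> \<open>Since \<open>?r\<close> is at least \<open>- Re ?w\<close>, this time costs
      the exponential no more than the factor \<open>exp (- 1)\<close>.\<close>
    have "- 1 \<le> t * Re ?w" using r0 \<beta> by (simp add: t_def field_simps)
    then have "cmod ?w * exp (- 1) \<le> cmod ?w * exp (t * Re ?w)" by (intro mult_left_mono) auto
    also have "\<dots> \<le> 2 * norm (\<nu>' t)" using diff[OF t z] by (simp add: norm_mult)
    also have "\<dots> \<le> 2 * (k / t)" using \<delta>(2)[OF t t\<delta>] by simp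
    also have "\<dots> = 2 * k * ?r" by (simp add: t_def)
    finally have "cmod ?w \<le> 2 * k * exp 1 * ?r" by (simp add: exp_minus field_simps)
    then have "cmod ?w < m * ?r" using r0 by (simp add: m_def distrib_right)
    moreover have "\<bar>Im (of_real \<beta> - ?w)\<bar> \<le> cmod ?w" using abs_Im_le_cmod[of ?w] by simp
    ultimately show ?thesis unfolding \<theta>_def by (intro abs_Arg_less_arctan[OF r0]) linarith
  qed

  have sector: "\<Psi> ` Pi_minus \<subseteq> truncated_sector \<theta> \<beta>" if "\<exists>z\<in>Pi_minus. \<Psi> z \<noteq> 0"
  proof safe
    fix z :: "complex ^ 'n" assume z: "z \<in> Pi_minus"
    have "\<Psi> z = of_real \<beta> + (\<Psi> z - of_real \<beta>)" by simp
    moreover have "\<Psi> z - of_real \<beta> \<noteq> 0" using Re_le[OF z] \<beta> by (auto simp: complex_eq_iff)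
    ultimately show "\<Psi> z \<in> truncated_sector \<theta> \<beta>"
      unfolding truncated_sector_def using Arg[OF z] Re_less[OF that z]
      by (intro IntI image_eqI[of _ _ "\<Psi> z - of_real \<beta>"]) auto
  qed

  \<comment> \<open>Growth along the diagonal ray and transfer to the whole domain\<close>
  define e :: "real ^ 'n" where "e = (\<chi> j. - 1)"
  define a where "a = \<beta> - \<psi> e"
  define \<gamma> where "\<gamma> = 2 * \<theta> / pi"
  have \<gamma>: "0 < \<gamma>" "\<gamma> < 1" using \<theta> by (auto simp: \<gamma>_def)
  \<comment> \<open>The explicit \<open>0 +\<close> matches the form \<open>a + l *s b\<close> of
    \<open>holomorphic_vec_line\<close>.\<close>
  have ray: "cvec (\<chi> j. - r) = 0 + of_real r *s cvec e" for r
    by (simp add: cvec_def e_def vec_eq_iff)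
  have ray_Pi: "0 + l *s cvec e \<in> Pi_minus \<longleftrightarrow> 0 < Re l" for l
    by (simp add: cvec_def e_def Pi_minus_def)
  have ray_neg: "(\<chi> j. - r) \<in> neg_orthant" if "0 < r" for r :: real
    using that by (simp add: neg_orthant_def)
  have real_growth: "\<beta> - \<psi> (\<chi> j. - r) \<le> a * r powr \<gamma>" if r: "1 \<le> r" for r
    unfolding \<gamma>_def
  proof (rule half_plane_sector_growth)
    show "(\<lambda>l. of_real \<beta> - \<Psi> (0 + l *s cvec e)) holomorphic_on {l. 0 < Re l}"
      using holomorphic_vec_line[OF hol, of 0 "cvec e"] unfolding ray_Pi
      by (intro holomorphic_intros)
    show "0 < Re (of_real \<beta> - \<Psi> (0 + l *s cvec e))" if "0 < Re l" for l
      using Re_le[OF ray_Pi[THEN iffD2, OF that]] \<beta> by simp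
    show "\<bar>Arg (of_real \<beta> - \<Psi> (0 + l *s cvec e))\<bar> < \<theta>" if "0 < Re l" for l
      using Arg[OF ray_Pi[THEN iffD2, OF that]] .
    show "of_real \<beta> - \<Psi> (0 + 1 *s cvec e) = of_real a"
      using real[OF ray_neg[of 1]] by (simp add: a_def e_def)
    show "of_real \<beta> - \<Psi> (0 + of_real r *s cvec e) = of_real (\<beta> - \<psi> (\<chi> j. - r))"
      using real[OF ray_neg[of r]] r unfolding ray by simp
  qed (use \<theta> r in auto)
  have a: "0 < a"
  proof -
    have e: "e \<in> neg_orthant" using ray_neg[of 1] by (simp add: e_def)
    have "cvec e \<in> Pi_minus" using ray_Pi[of 1] by simp
    then show ?thesis using Re_le[of "cvec e"] real[OF e] \<beta> by (simp add: a_def)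
  qed
  \<comment> \<open>Right derivatives at time 0 of the transforms at \<open>z\<close> and at the
    diagonal point are compared. The radius \<open>r\<close> is kept separate from
    \<open>max_norm z\<close> so that the bound also covers points of norm below 1.\<close>
  have growth: "cmod (\<Psi> z) \<le> 3 * a * r powr \<gamma>" if z: "z \<in> Pi_minus" and r: "max_norm z \<le> r" "1 \<le> r" for z r
  proof -
    let ?s = "(\<chi> j. - r) :: real ^ 'n"
    have r0: "0 < r" using r(2) by simp
    have "\<forall>s\<in>neg_orthant. \<psi> s \<le> 0" using assms(1) by (simp add: T0_class_def T_class_def)
    then have nonpos: "\<psi> ?s \<le> 0" using ray_neg[OF r0] by (rule bspec)
    have "((\<lambda>t. exp (of_real t * complex_of_real (\<psi> ?s))) has_vector_derivative of_real (\<psi> ?s)) (at 0 within {0<..})"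
      using deriv[of "of_real (\<psi> ?s)" 0] by simp
    moreover have "((\<lambda>t. exp (of_real t * \<Psi> z)) has_vector_derivative \<Psi> z) (at 0 within {0<..})"
      using deriv[of "\<Psi> z" 0] by simp
    ultimately have "cmod (\<Psi> z) \<le> 3 * cmod (of_real (\<psi> ?s))"
    proof (rule vector_derivative_norm_le)
      show "\<forall>\<^sub>F t in at 0 within {0<..}. cmod (exp (of_real t * \<Psi> z) - exp (of_real 0 * \<Psi> z))
          \<le> 3 * cmod (exp (of_real t * complex_of_real (\<psi> ?s)) - exp (of_real 0 * complex_of_real (\<psi> ?s)))"
        using eventually_at_right_less[of "0 :: real"]
      proof eventually_elim
        case (elim t)
        have "exp (of_real t * complex_of_real (\<psi> ?s)) - exp (of_real 0 * complex_of_real (\<psi> ?s))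
            = of_real (exp (t * \<psi> ?s) - 1)"
          by (simp flip: exp_of_real)
        moreover have "cmod (exp (of_real t * \<Psi> z) - 1) \<le> 3 * \<bar>exp (t * \<psi> ?s) - 1\<bar>"
          using orthant_measure.norm_laplace_minus_1_le[OF meas(1) meas(2) z r(1) r0, of t] elim
            lap[OF _ z, of t] assms(4)[OF _ ray_neg[OF r0], of t] by simp
        ultimately show ?case by (simp only: norm_of_real) simp
      qed
    qed simp
    also have "3 * cmod (of_real (\<psi> ?s)) \<le> 3 * (\<beta> - \<psi> ?s)" using \<beta> nonpos by simp
    also have "\<dots> \<le> 3 * (a * r powr \<gamma>)" using real_growth[OF r(2)] by simp
    finally show ?thesis by simp
  qed
  \<comment> \<open>Boundary points are reached by shifting \<open>z\<close> along the diagonal into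
    the open domain by \<open>d n\<close> and using continuity of \<open>\<Psi>\<close> on the
    closure.\<close>
  have "cmod (\<Psi> z) \<le> 3 * a * max_norm z powr \<gamma>" if z: "z \<in> closure Pi_minus" "1 \<le> max_norm z" for z
  proof -
    define d where "d n = inverse (real (Suc n))" for n
    define Z where "Z n = z + of_real (d n) *s cvec e" for n
    have d: "d \<longlonglongrightarrow> 0" "\<And>n. 0 < d n"
      unfolding d_def by (rule LIMSEQ_inverse_real_of_nat) simp
    have Z_nth: "Z n $ j = z $ j - of_real (d n)" for n j by (simp add: Z_def cvec_def e_def)
    have "closed {z :: complex ^ 'n. \<forall>j. Re (z $ j) \<le> 0}"
      by (intro closed_Collect_all closed_Collect_le continuous_intros)
    then have "closure Pi_minus \<subseteq> {z :: complex ^ 'n. \<forall>j. Re (z $ j) \<le> 0}"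
      by (intro closure_minimal) (auto simp: Pi_minus_def less_imp_le)
    then have "Re (z $ j) \<le> 0" for j using z(1) by blast
    then have Z: "Z n \<in> Pi_minus" for n
      using d(2) by (auto simp: Pi_minus_def Z_nth intro: le_less_trans)
    have "max_norm (Z n) \<le> max_norm z + d n" for n
      unfolding max_norm_def[of "Z n"]
    proof (intro Max.boundedI; clarsimp)
      show "cmod (Z n $ j) \<le> max_norm z + d n" for j
        using norm_triangle_ineq4[of "z $ j" "of_real (d n)"] norm_le_max_norm[of z j] d(2)[of n]
        by (simp add: Z_nth)
    qed
    \<comment> \<open>The norm of \<open>Z n\<close> may drop below 1, but the radius
      \<open>max_norm z + d n\<close> stays at least 1.\<close>
    then have le: "cmod (\<Psi> (Z n)) \<le> 3 * a * (max_norm z + d n) powr \<gamma>" for n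
      using growth[OF Z[of n], of "max_norm z + d n"] z(2) d(2)[of n] by simp
    have "Z \<longlonglongrightarrow> z"
    proof (rule vec_tendstoI)
      show "(\<lambda>n. Z n $ j) \<longlonglongrightarrow> z $ j" for j
        using tendsto_diff[OF tendsto_const[of "z $ j"] tendsto_of_real[OF d(1)]] by (simp add: Z_nth)
    qed
    then have "(\<lambda>n. \<Psi> (Z n)) \<longlonglongrightarrow> \<Psi> z"
      using Z closure_subset by (intro continuous_on_tendsto_compose[OF cont _ z(1)]) (auto intro!: always_eventually)
    moreover have "(\<lambda>n. 3 * a * (max_norm z + d n) powr \<gamma>) \<longlonglongrightarrow> 3 * a * (max_norm z + 0) powr \<gamma>"
      using z(2) by (intro tendsto_intros d(1)) auto
    ultimately show ?thesis
      using le by (auto intro!: LIMSEQ_le[OF tendsto_norm])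
  qed
  then show ?thesis
    using sector \<theta> \<beta> \<gamma> a by (intro conjI impI exI[of _ \<theta>] exI[of _ \<beta>] exI[of _ "3 * a"] exI[of _ \<gamma>]) auto
qed

end
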